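(* Let $S\simeq(E\times F)/G$ be a bielliptic surface over $\mathbb{C}$, written as one of the types 1)–7) listed in the context. Let $C$ be a smooth projective curve and $\pi:S\to C$ a morphism with a section $\sigma:C\to S$ (that is, $\pi\circ\sigma=\mathrm{id}_C$). Then: a) $E/G\simeq C$. b) The action of $G$ on $F$ has a fixed point $P$. c) $S$ is of type 1), 3), 5) or 7). Moreover, $\pi=p_1$ is the first projection $(E\times F)/G\to E/G$ and $\sigma:E/G\to S\simeq(E\times F)/G$ is of the form $\sigma(x)=(x,P)$ (i.e. the class of $x\in E$ is sent to the class of $(x,P)$, where $P\in F$ is a fixed point of $G$).
   Context: A bielliptic surface is a surface $S\simeq(E\times F)/G$ where $E,F$ are elliptic curves and $G$ is a finite group of translations of $E$ acting also on $F$ with $F/G\simeq\mathbb{P}^1$; $G$ acts diagonally on $E\times F$. Every bielliptic surface is of one of the following types. Let $F_i=\mathbb{C}/(\mathbb{Z}\oplus\mathbb{Z}i)$ and $F_\rho=\mathbb{C}/(\mathbb{Z}\oplus\mathbb{Z}\rho)$ with $\rho$ a primitive cubic root of unity. 1) $(E\times F)/G$, $G=\mathbb{Z}/2\mathbb{Z}$ acting on $F$ by $x\mapsto -x$. 2) $(E\times F)/G$, $G=\mathbb{Z}/2\mathbb{Z}\oplus\mathbb{Z}/2\mathbb{Z}$ acting on $F$ by $x\mapsto -x$, $x\mapsto x+\varepsilon$, where $\varepsilon$ is a (nonzero) 2-torsion point of $F$. 3) $(E\times F_i)/G$, $G=\mathbb{Z}/4\mathbb{Z}$ acting on $F=F_i$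 by $x\mapsto ix$. 4) $(E\times F_i)/G$, $G=\mathbb{Z}/4\mathbb{Z}\oplus\mathbb{Z}/2\mathbb{Z}$ acting on $F=F_i$ by $x\mapsto ix$, $x\mapsto x+\frac{1+i}{2}$. 5) $(E\times F_\rho)/G$, $G=\mathbb{Z}/3\mathbb{Z}$ acting on $F=F_\rho$ by $x\mapsto\rho x$. 6) $(E\times F_\rho)/G$, $G=\mathbb{Z}/3\mathbb{Z}\oplus\mathbb{Z}/3\mathbb{Z}$ acting on $F=F_\rho$ by $x\mapsto\rho x$, $x\mapsto x+\frac{1-\rho}{3}$. 7) $(E\times F_\rho)/G$, $G=\mathbb{Z}/6\mathbb{Z}$ acting on $F=F_\rho$ by $x\mapsto-\rho x$. The equality $\pi=p_1$ is understood via the identification $C\simeq E/G$. *)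

theory Defs
  imports
    "HOL-Analysis.Analysis"
    "HOL-Complex_Analysis.Complex_Analysis"
    "HOL-Algebra.Group_Action"
    "HOL-Algebra.Elementary_Groups"
begin

section \<open>Spaces with functions\<close>

text \<open>
  Varieties and complex spaces are both treated as topological spaces with a sheaf of
  complex-valued functions. A section over an open set \<open>V\<close> is represented by a total function
  of which only the values on \<open>V\<close> matter.
\<close>

record 'a fspace =
  fs_top :: "'a topology"
  fs_sections :: "'a set \<Rightarrow> ('a \<Rightarrow> complex) set"

abbreviation points :: "'a fspace \<Rightarrow> 'a set" where
  "points X \<equiv> topspace (fs_top X)"

definition fs_morphism :: "'a fspace \<Rightarrow> 'b fspace \<Rightarrow> ('a \<Rightarrow> 'b) \<Rightarrow> bool" where
  "fs_morphism X Y f \<longleftrightarrow>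
     continuous_map (fs_top X) (fs_top Y) f \<and>
     (\<forall>V u. openin (fs_top Y) V \<longrightarrow> u \<in> fs_sections Y V \<longrightarrow>
        u \<circ> f \<in> fs_sections X {x \<in> points X. f x \<in> V})"

definition fs_iso :: "'a fspace \<Rightarrow> 'b fspace \<Rightarrow> ('a \<Rightarrow> 'b) \<Rightarrow> bool" where
  "fs_iso X Y f \<longleftrightarrow>
     fs_morphism X Y f \<and>
     (\<exists>g. fs_morphism Y X g \<and> (\<forall>x\<in>points X. g (f x) = x) \<and> (\<forall>y\<in>points Y. f (g y) = y))"

definition fs_sub :: "'a fspace \<Rightarrow> 'a set \<Rightarrow> 'a fspace" where
  "fs_sub X A =
     \<lparr> fs_top = subtopology (fs_top X) A,
       fs_sections = (\<lambda>V. {u. \<forall>p\<in>V. \<exists>W w. openin (fs_top X) W \<and> p \<in> W \<and>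
                            w \<in> fs_sections X W \<and> (\<forall>x\<in>V \<inter> W. u x = w x)}) \<rparr>"

definition quotient_top :: "'a topology \<Rightarrow> ('a \<Rightarrow> 'b) \<Rightarrow> 'b topology" where
  "quotient_top T q =
     topology (\<lambda>U. U \<subseteq> q ` topspace T \<and> openin T {x \<in> topspace T. q x \<in> U})"

lemma openin_quotient_top:
  "openin (quotient_top T q) U \<longleftrightarrow>
     U \<subseteq> q ` topspace T \<and> openin T {x \<in> topspace T. q x \<in> U}"
proof -
  have "istopology (\<lambda>U. U \<subseteq> q ` topspace T \<and> openin T {x \<in> topspace T. q x \<in> U})"
    unfolding istopology_def
  proof (intro conjI allI impI)
    fix S U
    assume S: "S \<subseteq> q ` topspace T \<and> openin T {x \<in> topspace T. q x \<in> S}"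
      and U: "U \<subseteq> q ` topspace T \<and> openin T {x \<in> topspace T. q x \<in> U}"
    have "{x \<in> topspace T. q x \<in> S \<inter> U} =
        {x \<in> topspace T. q x \<in> S} \<inter> {x \<in> topspace T. q x \<in> U}" by auto
    with S U show "openin T {x \<in> topspace T. q x \<in> S \<inter> U}" by auto
    show "S \<inter> U \<subseteq> q ` topspace T" using S by auto
  next
    fix K
    assume K: "\<forall>S\<in>K. S \<subseteq> q ` topspace T \<and> openin T {x \<in> topspace T. q x \<in> S}"
    have "{x \<in> topspace T. q x \<in> \<Union>K} = (\<Union>S\<in>K. {x \<in> topspace T. q x \<in> S})" by auto
    with K show "openin T {x \<in> topspace T. q x \<in> \<Union>K}" by auto
    show "\<Union>K \<subseteq> q ` topspace T" using K by auto
  qed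
  then show ?thesis by (simp add: quotient_top_def)
qed

lemma topspace_quotient_top: "topspace (quotient_top T q) = q ` topspace T"
proof
  show "topspace (quotient_top T q) \<subseteq> q ` topspace T"
    using openin_topspace[of "quotient_top T q"] openin_quotient_top by metis
  have "{x \<in> topspace T. q x \<in> q ` topspace T} = topspace T" by auto
  then have "openin (quotient_top T q) (q ` topspace T)"
    by (simp add: openin_quotient_top)
  then show "q ` topspace T \<subseteq> topspace (quotient_top T q)"
    by (rule openin_subset)
qed

definition fs_quotient :: "'a fspace \<Rightarrow> ('a \<Rightarrow> 'b) \<Rightarrow> 'b fspace" where
  "fs_quotient X q =
     \<lparr> fs_top = quotient_top (fs_top X) q,
       fs_sections = (\<lambda>V. {u. u \<circ> q \<in> fs_sections X {x \<in> points X. q x \<in> V}}) \<rparr>"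

section \<open>Affine complex spaces with holomorphic functions\<close>

definition hol_C :: "complex fspace" where
  "hol_C = \<lparr> fs_top = euclidean, fs_sections = (\<lambda>U. {f. f holomorphic_on U}) \<rparr>"

definition hol_C2 :: "(complex \<times> complex) fspace" where
  "hol_C2 =
     \<lparr> fs_top = euclidean,
       fs_sections = (\<lambda>U. {f. \<forall>p\<in>U. \<exists>a b.
         (f has_derivative (\<lambda>(v, w). a * v + b * w)) (at p)}) \<rparr>"

definition hol_Cn :: "(complex ^ 'n) fspace" where
  "hol_Cn =
     \<lparr> fs_top = euclidean,
       fs_sections = (\<lambda>U. {f. \<forall>p\<in>U. \<exists>a :: complex ^ 'n.
         (f has_derivative (\<lambda>v. \<Sum>i\<in>UNIV. a $ i * v $ i)) (at p)}) \<rparr>"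

section \<open>Projective space and projective varieties\<close>

text \<open>
  The points of the projective space of dimension \<open>CARD('n) - 1\<close> are the punctured lines
  through the origin of \<open>complex ^ 'n\<close>.
\<close>

definition line :: "complex ^ 'n \<Rightarrow> (complex ^ 'n) set" where
  "line v = {c *s v | c. c \<noteq> 0}"

definition is_form :: "nat \<Rightarrow> (complex ^ 'n \<Rightarrow> complex) \<Rightarrow> bool" where
  "is_form d f \<longleftrightarrow>
     (\<exists>c :: ('n \<Rightarrow> nat) \<Rightarrow> complex.
        f = (\<lambda>v. \<Sum>m\<in>{m. (\<Sum>i\<in>UNIV. m i) = d}. c m * (\<Prod>i\<in>UNIV. (v $ i) ^ m i)))"

text \<open>The principal open sets of forms generate the Zariski topology.\<close>

definition zariski :: "(complex ^ 'n) set topology" where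
  "zariski = topology_generated_by
     {{line v | v. v \<noteq> 0 \<and> f v \<noteq> 0} | f. \<exists>d. is_form d f}"

definition alg_proj_space :: "(complex ^ 'n) set fspace" where
  "alg_proj_space =
     \<lparr> fs_top = zariski,
       fs_sections = (\<lambda>U. {u. \<forall>p\<in>U. \<exists>W d f g. openin zariski W \<and> p \<in> W \<and> W \<subseteq> U \<and>
         is_form d f \<and> is_form d g \<and>
         (\<forall>v. v \<noteq> 0 \<longrightarrow> line v \<in> W \<longrightarrow> g v \<noteq> 0 \<and> u (line v) = f v / g v)}) \<rparr>"

definition hol_proj_space :: "(complex ^ 'n) set fspace" where
  "hol_proj_space = fs_quotient (fs_sub hol_Cn (- {0})) line"

abbreviation alg :: "(complex ^ 'n) set set \<Rightarrow> (complex ^ 'n) set fspace" where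
  "alg X \<equiv> fs_sub alg_proj_space X"

text \<open>The complex space associated with a variety.\<close>

abbreviation an :: "(complex ^ 'n) set set \<Rightarrow> (complex ^ 'n) set fspace" where
  "an X \<equiv> fs_sub hol_proj_space X"

definition irreducible_top :: "'a topology \<Rightarrow> bool" where
  "irreducible_top T \<longleftrightarrow>
     topspace T \<noteq> {} \<and>
     (\<forall>A B. closedin T A \<longrightarrow> closedin T B \<longrightarrow> A \<union> B = topspace T \<longrightarrow>
        A = topspace T \<or> B = topspace T)"

definition irreducible_chain :: "'a topology \<Rightarrow> nat \<Rightarrow> (nat \<Rightarrow> 'a set) \<Rightarrow> bool" where
  "irreducible_chain T d Z \<longleftrightarrow>
     (\<forall>i\<le>d. closedin T (Z i) \<and> irreducible_top (subtopology T (Z i))) \<and>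
     (\<forall>i<d. Z i \<subset> Z (Suc i))"

definition has_krull_dim :: "'a topology \<Rightarrow> nat \<Rightarrow> bool" where
  "has_krull_dim T d \<longleftrightarrow>
     (\<exists>Z. irreducible_chain T d Z) \<and> \<not> (\<exists>Z. irreducible_chain T (Suc d) Z)"

text \<open>The Zariski tangent space at \<open>v\<close> of the affine cone over \<open>X\<close>.\<close>

definition cone_tangent_space ::
    "(complex ^ 'n) set set \<Rightarrow> complex ^ 'n \<Rightarrow> (complex ^ 'n) set" where
  "cone_tangent_space X v =
     {w. \<forall>d f. is_form d f \<longrightarrow> (\<forall>x. x \<noteq> 0 \<longrightarrow> line x \<in> X \<longrightarrow> f x = 0) \<longrightarrow>
           frechet_derivative f (at v) w = 0}"

text \<open>
  Smoothness is the Jacobian criterion. The tangent space of the cone also contains the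
  direction of the line itself, hence its dimension is \<open>d + 1\<close>.
\<close>

definition smooth_projective_variety :: "nat \<Rightarrow> (complex ^ 'n) set set \<Rightarrow> bool" where
  "smooth_projective_variety d X \<longleftrightarrow>
     closedin zariski X \<and>
     irreducible_top (subtopology zariski X) \<and>
     has_krull_dim (subtopology zariski X) d \<and>
     (\<forall>v. v \<noteq> 0 \<longrightarrow> line v \<in> X \<longrightarrow> vec.dim (cone_tangent_space X v) = d + 1)"

section \<open>Elliptic curves as complex tori\<close>

definition lattice :: "complex \<Rightarrow> complex \<Rightarrow> complex set" where
  "lattice a b = {of_int m * a + of_int n * b | m n. True}"

definition is_lattice :: "complex set \<Rightarrow> bool" where
  "is_lattice L \<longleftrightarrow> (\<exists>a b. a \<noteq> 0 \<and> Im (b / a) \<noteq> 0 \<and> L = lattice a b)"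

definition complex_add_group :: "complex monoid" where
  "complex_add_group = \<lparr> carrier = UNIV, monoid.mult = (+), one = 0 \<rparr>"

definition torus :: "complex set \<Rightarrow> complex set monoid" where
  "torus L = complex_add_group Mod L"

definition tpt :: "complex set \<Rightarrow> complex \<Rightarrow> complex set" where
  "tpt L z = L #>\<^bsub>complex_add_group\<^esub> z"

definition torus_space :: "complex set \<Rightarrow> complex set fspace" where
  "torus_space L = fs_quotient hol_C (tpt L)"

definition torus_product :: "complex set \<Rightarrow> complex set \<Rightarrow> (complex set \<times> complex set) fspace"
  where "torus_product L M = fs_quotient hol_C2 (\<lambda>(z, w). (tpt L z, tpt M w))"

section \<open>Bielliptic surfaces\<close>

text \<open>
  In what follows \<open>L\<close> and \<open>M\<close> are the lattices of \<open>E\<close> and \<open>F\<close>. The group \<open>G\<close> of translations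
  of \<open>E\<close> is given by the subgroup of \<open>E\<close> of the translation vectors, and \<open>\<alpha>\<close> is its action
  on \<open>F\<close>.
\<close>

abbreviation translation_group :: "complex set \<Rightarrow> complex set set \<Rightarrow> complex set monoid" where
  "translation_group L G \<equiv> (torus L)\<lparr>carrier := G\<rparr>"

definition E_class :: "complex set \<Rightarrow> complex set set \<Rightarrow> complex set \<Rightarrow> complex set set" where
  "E_class L G x = orbit (translation_group L G) (\<lambda>g x. x \<otimes>\<^bsub>torus L\<^esub> g) x"

definition EF_class ::
    "complex set \<Rightarrow> complex set set \<Rightarrow> (complex set \<Rightarrow> complex set \<Rightarrow> complex set) \<Rightarrow>
     complex set \<times> complex set \<Rightarrow> (complex set \<times> complex set) set" where
  "EF_class L G \<alpha> p =
     orbit (translation_group L G) (\<lambda>g (x, y). (x \<otimes>\<^bsub>torus L\<^esub> g, \<alpha> g y)) p"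

definition E_mod_G :: "complex set \<Rightarrow> complex set set \<Rightarrow> complex set set fspace" where
  "E_mod_G L G = fs_quotient (torus_space L) (E_class L G)"

definition F_mod_G ::
    "complex set \<Rightarrow> complex set \<Rightarrow> complex set set \<Rightarrow>
     (complex set \<Rightarrow> complex set \<Rightarrow> complex set) \<Rightarrow> complex set set fspace" where
  "F_mod_G L M G \<alpha> = fs_quotient (torus_space M) (orbit (translation_group L G) \<alpha>)"

definition EF_mod_G ::
    "complex set \<Rightarrow> complex set \<Rightarrow> complex set set \<Rightarrow>
     (complex set \<Rightarrow> complex set \<Rightarrow> complex set) \<Rightarrow> (complex set \<times> complex set) set fspace" where
  "EF_mod_G L M G \<alpha> = fs_quotient (torus_product L M) (EF_class L G \<alpha>)"

definition bielliptic_data ::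
    "complex set \<Rightarrow> complex set \<Rightarrow> complex set set \<Rightarrow>
     (complex set \<Rightarrow> complex set \<Rightarrow> complex set) \<Rightarrow> bool" where
  "bielliptic_data L M G \<alpha> \<longleftrightarrow>
     is_lattice L \<and> is_lattice M \<and>
     subgroup G (torus L) \<and> finite G \<and>
     group_action (translation_group L G) (carrier (torus M)) \<alpha> \<and>
     (\<forall>g\<in>G. fs_iso (torus_space M) (torus_space M) (\<alpha> g)) \<and>
     (\<exists>h. fs_iso (F_mod_G L M G \<alpha>) (hol_proj_space :: (complex ^ 2) set fspace) h)"

datatype bielliptic_type = Type1 | Type2 | Type3 | Type4 | Type5 | Type6 | Type7

text \<open>The automorphism of \<open>F\<close> given by \<open>g\<close> is induced by the self-map \<open>f\<close> of the plane.\<close>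

definition acts_by ::
    "complex set \<Rightarrow> (complex set \<Rightarrow> complex set \<Rightarrow> complex set) \<Rightarrow> complex set \<Rightarrow>
     (complex \<Rightarrow> complex) \<Rightarrow> bool" where
  "acts_by M \<alpha> g f \<longleftrightarrow> (\<forall>z. \<alpha> g (tpt M z) = tpt M (f z))"

definition cyclic_type ::
    "nat \<Rightarrow> (complex \<Rightarrow> complex) \<Rightarrow> complex set \<Rightarrow> complex set \<Rightarrow> complex set set \<Rightarrow>
     (complex set \<Rightarrow> complex set \<Rightarrow> complex set) \<Rightarrow> bool" where
  "cyclic_type m f L M G \<alpha> \<longleftrightarrow>
     (\<exists>\<psi>\<in>iso (integer_mod_group m) (translation_group L G). acts_by M \<alpha> (\<psi> 1) f)"

definition bicyclic_type ::
    "nat \<Rightarrow> nat \<Rightarrow> (complex \<Rightarrow> complex) \<Rightarrow> (complex \<Rightarrow> complex) \<Rightarrow> complex set \<Rightarrow>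
     complex set \<Rightarrow> complex set set \<Rightarrow> (complex set \<Rightarrow> complex set \<Rightarrow> complex set) \<Rightarrow> bool" where
  "bicyclic_type m n f f' L M G \<alpha> \<longleftrightarrow>
     (\<exists>\<psi>\<in>iso (integer_mod_group m \<times>\<times> integer_mod_group n) (translation_group L G).
        acts_by M \<alpha> (\<psi> (1, 0)) f \<and> acts_by M \<alpha> (\<psi> (0, 1)) f')"

fun has_bielliptic_type ::
    "complex \<Rightarrow> bielliptic_type \<Rightarrow> complex set \<Rightarrow> complex set \<Rightarrow> complex set set \<Rightarrow>
     (complex set \<Rightarrow> complex set \<Rightarrow> complex set) \<Rightarrow> bool" where
  "has_bielliptic_type \<rho> Type1 L M G \<alpha> \<longleftrightarrow> cyclic_type 2 (\<lambda>z. - z) L M G \<alpha>"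
| "has_bielliptic_type \<rho> Type2 L M G \<alpha> \<longleftrightarrow>
     (\<exists>\<epsilon>. \<epsilon> \<notin> M \<and> 2 * \<epsilon> \<in> M \<and> bicyclic_type 2 2 (\<lambda>z. - z) (\<lambda>z. z + \<epsilon>) L M G \<alpha>)"
| "has_bielliptic_type \<rho> Type3 L M G \<alpha> \<longleftrightarrow>
     M = lattice 1 \<i> \<and> cyclic_type 4 (\<lambda>z. \<i> * z) L M G \<alpha>"
| "has_bielliptic_type \<rho> Type4 L M G \<alpha> \<longleftrightarrow>
     M = lattice 1 \<i> \<and>
     bicyclic_type 4 2 (\<lambda>z. \<i> * z) (\<lambda>z. z + (1 + \<i>) / 2) L M G \<alpha>"
| "has_bielliptic_type \<rho> Type5 L M G \<alpha> \<longleftrightarrow>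
     M = lattice 1 \<rho> \<and> cyclic_type 3 (\<lambda>z. \<rho> * z) L M G \<alpha>"
| "has_bielliptic_type \<rho> Type6 L M G \<alpha> \<longleftrightarrow>
     M = lattice 1 \<rho> \<and>
     bicyclic_type 3 3 (\<lambda>z. \<rho> * z) (\<lambda>z. z + (1 - \<rho>) / 3) L M G \<alpha>"
| "has_bielliptic_type \<rho> Type7 L M G \<alpha> \<longleftrightarrow>
     M = lattice 1 \<rho> \<and> cyclic_type 6 (\<lambda>z. - \<rho> * z) L M G \<alpha>"

end

theory Submission
  imports Defs "HOL-Algebra.Multiplicative_Group"
begin

text \<open>
  The composition \<open>e = \<sigma> \<circ> \<pi>\<close> is a holomorphic map of the surface into itself with \<open>e \<circ> e = e\<close>,
  and \<open>\<pi>\<close> identifies its image with \<open>C\<close>. The proof determines all such retractions of a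
  bielliptic surface.

  The surface is the quotient of the plane by the group of deck transformations
  \<open>(z, w) \<mapsto> (z + l, \<zeta> w + t)\<close> with \<open>\<bar>\<zeta>\<bar> = 1\<close>. A holomorphic map of the surface into itself
  lifts to a holomorphic map \<open>g\<close> of the plane (\<open>holomorphic_lift\<close>). Deck transformations are
  isometries, hence \<open>dist (g (v + h)) (g v)\<close> is periodic in \<open>v\<close> and therefore bounded, and
  Liouville's theorem makes \<open>g\<close> affine (\<open>periodic_lift_affine\<close>). Some deck transformation has
  \<open>\<zeta> \<noteq> 1\<close>. That \<open>g\<close> maps its orbits to orbits, and that \<open>e\<close> is idempotent, are conditions on the
  six coefficients of \<open>g\<close> which leave three cases (\<open>retraction_cases\<close>): \<open>e\<close> is constant, or \<open>e\<close> is
  the identity, or \<open>e\<close> sends the class of \<open>(x, y)\<close> to the class of \<open>(x, P)\<close> with \<open>P\<close> fixed by \<open>G\<close>.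
  The first two are impossible because \<open>C\<close> has dimension one. In the third, \<open>\<pi>\<close> is the first
  projection followed by the map \<open>h\<close> induced by \<open>x \<mapsto> \<pi> (x, P)\<close>, and \<open>h\<close> is an isomorphism
  because the first projection of \<open>\<sigma>\<close> is its inverse (\<open>fibration_with_section\<close>). A group that
  contains a translation of \<open>F\<close> has no fixed point, which leaves the four cyclic types.

  Since \<open>\<pi>\<close> and \<open>\<sigma>\<close> are morphisms of varieties while the argument is analytic, regular maps have
  to be recognised as holomorphic ones first (\<open>alg_morphism_imp_an_morphism\<close>).
\<close>

section \<open>Morphisms of spaces with functions\<close>

lemma fs_morphism_continuous: "fs_morphism X Y f \<Longrightarrow> continuous_map (fs_top X) (fs_top Y) f"
  by (simp add: fs_morphism_def)

lemma fs_morphism_sections: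
  "fs_morphism X Y f \<Longrightarrow> openin (fs_top Y) V \<Longrightarrow> u \<in> fs_sections Y V \<Longrightarrow>
    u \<circ> f \<in> fs_sections X {x \<in> points X. f x \<in> V}"
  by (simp add: fs_morphism_def)

lemma fs_morphismI:
  assumes "continuous_map (fs_top X) (fs_top Y) f"
    and "\<And>V u. openin (fs_top Y) V \<Longrightarrow> u \<in> fs_sections Y V \<Longrightarrow>
      u \<circ> f \<in> fs_sections X {x \<in> points X. f x \<in> V}"
  shows "fs_morphism X Y f"
  using assms by (simp add: fs_morphism_def)

lemma fs_morphism_points: "fs_morphism X Y f \<Longrightarrow> x \<in> points X \<Longrightarrow> f x \<in> points Y"
  by (auto dest!: fs_morphism_continuous simp: continuous_map_def)

lemma fs_morphism_comp:
  assumes f: "fs_morphism X Y f" and g: "fs_morphism Y Z g"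
  shows "fs_morphism X Z (g \<circ> f)"
proof (rule fs_morphismI)
  show "continuous_map (fs_top X) (fs_top Z) (g \<circ> f)"
    by (rule continuous_map_compose[OF f[THEN fs_morphism_continuous] g[THEN fs_morphism_continuous]])
  fix V u assume V: "openin (fs_top Z) V" and u: "u \<in> fs_sections Z V"
  let ?W = "{y \<in> points Y. g y \<in> V}"
  have "openin (fs_top Y) ?W"
    by (rule openin_continuous_map_preimage[OF g[THEN fs_morphism_continuous] V])
  from fs_morphism_sections[OF f this fs_morphism_sections[OF g V u]]
  have "u \<circ> g \<circ> f \<in> fs_sections X {x \<in> points X. f x \<in> ?W}" .
  moreover have "{x \<in> points X. f x \<in> ?W} = {x \<in> points X. (g \<circ> f) x \<in> V}"
    using fs_morphism_points[OF f] by auto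
  ultimately show "u \<circ> (g \<circ> f) \<in> fs_sections X {x \<in> points X. (g \<circ> f) x \<in> V}"
    by (simp only: comp_assoc)
qed

lemma points_fs_quotient [simp]: "points (fs_quotient X q) = q ` points X"
  by (simp add: fs_quotient_def topspace_quotient_top)

lemma openin_fs_quotient:
  "openin (fs_top (fs_quotient X q)) U \<longleftrightarrow>
    U \<subseteq> q ` points X \<and> openin (fs_top X) {x \<in> points X. q x \<in> U}"
  by (simp add: fs_quotient_def openin_quotient_top)

lemma sections_fs_quotient:
  "u \<in> fs_sections (fs_quotient X q) V \<longleftrightarrow> u \<circ> q \<in> fs_sections X {x \<in> points X. q x \<in> V}"
  by (simp add: fs_quotient_def)

lemma fs_morphism_quotient_map: "fs_morphism X (fs_quotient X q) q"
  by (rule fs_morphismI) (simp_all add: continuous_map_def openin_fs_quotient sections_fs_quotient)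

text \<open>
  The universal property of the quotient. Together with \<open>fs_quotient_fs_quotient\<close> it reduces
  statements about \<open>E/G\<close> and \<open>(E \<times> F)/G\<close> to statements about the line and the plane.
\<close>

lemma fs_morphism_from_quotient:
  assumes "fs_morphism X Y (p \<circ> q)"
  shows "fs_morphism (fs_quotient X q) Y p"
proof (rule fs_morphismI)
  have eq: "{x \<in> points X. q x \<in> {y \<in> points (fs_quotient X q). p y \<in> V}}
      = {x \<in> points X. (p \<circ> q) x \<in> V}" for V
    by auto
  show "continuous_map (fs_top (fs_quotient X q)) (fs_top Y) p"
    unfolding continuous_map_def openin_fs_quotient eq
    using fs_morphism_points[OF assms]
      openin_continuous_map_preimage[OF fs_morphism_continuous[OF assms]] by auto
  fix V u assume "openin (fs_top Y) V" "u \<in> fs_sections Y V"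
  from fs_morphism_sections[OF assms this]
  show "u \<circ> p \<in> fs_sections (fs_quotient X q) {x \<in> points (fs_quotient X q). p x \<in> V}"
    unfolding sections_fs_quotient eq by (simp only: comp_assoc)
qed

lemma fs_quotient_fs_quotient: "fs_quotient (fs_quotient X q) r = fs_quotient X (r \<circ> q)"
proof -
  have "{x \<in> points X. q x \<in> {y \<in> q ` points X. r y \<in> V}} = {x \<in> points X. (r \<circ> q) x \<in> V}" for V
    by auto
  then have eq: "{x \<in> points X. q x \<in> q ` points X \<and> r (q x) \<in> V} = {x \<in> points X. r (q x) \<in> V}" for V
    by auto
  have "quotient_top (quotient_top (fs_top X) q) r = quotient_top (fs_top X) (r \<circ> q)"
    unfolding topology_eq openin_quotient_top topspace_quotient_top by (auto simp: eq image_comp)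
  then show ?thesis
    by (simp add: fs_quotient_def topspace_quotient_top comp_assoc eq)
qed

section \<open>Regular maps are holomorphic\<close>

text \<open>
  Complex differentiability with the derivative only required to be complex homogeneous, which
  spares the closure properties the coefficients of the derivative.
\<close>

definition hol_Cn_at :: "(complex ^ 'n \<Rightarrow> complex) \<Rightarrow> complex ^ 'n \<Rightarrow> bool" where
  "hol_Cn_at f p \<longleftrightarrow> (\<exists>D. (f has_derivative D) (at p) \<and> (\<forall>c v. D (c *s v) = c * D v))"

lemma hol_Cn_at_iff_coefficients:
  fixes f :: "complex ^ 'n \<Rightarrow> complex"
  shows "hol_Cn_at f p \<longleftrightarrow>
    (\<exists>a :: complex ^ 'n. (f has_derivative (\<lambda>v. \<Sum>i\<in>UNIV. a $ i * v $ i)) (at p))"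
proof
  assume "hol_Cn_at f p"
  then obtain D where D: "(f has_derivative D) (at p)" "\<And>c v. D (c *s v) = c * D v"
    by (auto simp: hol_Cn_at_def)
  have lin: "linear D" using D(1) has_derivative_linear by blast
  have "D v = (\<Sum>i\<in>UNIV. (\<chi> i. D (axis i 1)) $ i * v $ i)" for v
  proof -
    have "D v = D (\<Sum>i\<in>UNIV. v $ i *s axis i 1)" by (simp add: basis_expansion)
    also have "\<dots> = (\<Sum>i\<in>UNIV. v $ i * D (axis i 1))"
      by (simp add: linear_sum[OF lin] D(2))
    finally show ?thesis by (simp add: mult.commute)
  qed
  then show "\<exists>a :: complex ^ 'n. (f has_derivative (\<lambda>v. \<Sum>i\<in>UNIV. a $ i * v $ i)) (at p)"
    using D(1) by (metis (no_types, lifting) ext)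
next
  assume "\<exists>a :: complex ^ 'n. (f has_derivative (\<lambda>v. \<Sum>i\<in>UNIV. a $ i * v $ i)) (at p)"
  then show "hol_Cn_at f p"
    unfolding hol_Cn_at_def by (force simp: sum_distrib_left mult_ac)
qed

lemma hol_Cn_at_const: "hol_Cn_at (\<lambda>v. c) p"
  unfolding hol_Cn_at_def by (rule exI[of _ "\<lambda>v. 0"]) auto

lemma hol_Cn_at_coord: "hol_Cn_at (\<lambda>v. v $ i) p"
  unfolding hol_Cn_at_def
  by (rule exI[of _ "\<lambda>v. v $ i"])
     (auto intro: bounded_linear_imp_has_derivative bounded_linear_vec_nth)

lemma hol_Cn_at_mult:
  assumes "hol_Cn_at f p" "hol_Cn_at g p" shows "hol_Cn_at (\<lambda>v. f v * g v) p"
proof -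
  from assms obtain D D' where D: "(f has_derivative D) (at p)" "\<And>c v. D (c *s v) = c * D v"
    and D': "(g has_derivative D') (at p)" "\<And>c v. D' (c *s v) = c * D' v"
    by (auto simp: hol_Cn_at_def)
  show ?thesis unfolding hol_Cn_at_def
    by (rule exI, rule conjI, rule has_derivative_mult[OF D(1) D'(1)])
       (simp add: D(2) D'(2) algebra_simps)
qed

lemma hol_Cn_at_sum:
  assumes "\<And>m. m \<in> A \<Longrightarrow> hol_Cn_at (f m) p" shows "hol_Cn_at (\<lambda>v. \<Sum>m\<in>A. f m v) p"
proof -
  from assms obtain D where D: "\<And>m. m \<in> A \<Longrightarrow> (f m has_derivative D m) (at p)"
    "\<And>m c v. m \<in> A \<Longrightarrow> D m (c *s v) = c * D m v"
    unfolding hol_Cn_at_def by metis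
  show ?thesis unfolding hol_Cn_at_def
    by (rule exI, rule conjI, rule has_derivative_sum[OF D(1)])
       (auto simp: D(2) sum_distrib_left)
qed

lemma hol_Cn_at_power: "hol_Cn_at f p \<Longrightarrow> hol_Cn_at (\<lambda>v. f v ^ k) p"
  by (induction k) (auto intro: hol_Cn_at_const hol_Cn_at_mult)

lemma hol_Cn_at_prod:
  "finite A \<Longrightarrow> (\<And>i. i \<in> A \<Longrightarrow> hol_Cn_at (f i) p) \<Longrightarrow> hol_Cn_at (\<lambda>v. \<Prod>i\<in>A. f i v) p"
  by (induction A rule: finite_induct) (auto intro: hol_Cn_at_const hol_Cn_at_mult)

lemma hol_Cn_at_inverse:
  assumes "hol_Cn_at f p" "f p \<noteq> 0" shows "hol_Cn_at (\<lambda>v. inverse (f v)) p"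
proof -
  from assms obtain D where D: "(f has_derivative D) (at p)" "\<And>c v. D (c *s v) = c * D v"
    by (auto simp: hol_Cn_at_def)
  show ?thesis unfolding hol_Cn_at_def
    by (rule exI, rule conjI, rule Deriv.has_derivative_inverse[OF assms(2) D(1)])
       (simp add: D(2))
qed

lemma hol_Cn_at_divide:
  "hol_Cn_at f p \<Longrightarrow> hol_Cn_at g p \<Longrightarrow> g p \<noteq> 0 \<Longrightarrow> hol_Cn_at (\<lambda>v. f v / g v) p"
  by (simp add: divide_inverse hol_Cn_at_mult hol_Cn_at_inverse)

lemma hol_Cn_at_compose:
  fixes F :: "complex ^ 'm \<Rightarrow> complex ^ 'n"
  assumes g: "hol_Cn_at g (F p)" and F: "\<And>i. hol_Cn_at (\<lambda>v. F v $ i) p"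
  shows "hol_Cn_at (\<lambda>v. g (F v)) p"
proof -
  from g obtain D where D: "(g has_derivative D) (at (F p))" "\<And>c v. D (c *s v) = c * D v"
    by (auto simp: hol_Cn_at_def)
  from F obtain E where E: "\<And>i. ((\<lambda>v. F v $ i) has_derivative E i) (at p)"
    "\<And>i c v. E i (c *s v) = c * E i v"
    unfolding hol_Cn_at_def by metis
  let ?E = "\<lambda>h. \<chi> i. E i h"
  have "(F has_derivative ?E) (at p)"
    unfolding has_derivative_componentwise_within[of F]
    by (auto simp: Basis_vec_def inner_axis intro!: has_derivative_inner_left E)
  from has_derivative_compose[OF this D(1)]
  have "((\<lambda>v. g (F v)) has_derivative (\<lambda>h. D (?E h))) (at p)" .
  moreover have "?E (c *s v) = c *s ?E v" for c v by (simp add: vec_eq_iff E)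
  ultimately show ?thesis unfolding hol_Cn_at_def using D(2) by metis
qed

lemma hol_Cn_at_cong_open:
  assumes "hol_Cn_at f p" "open U" "p \<in> U" "\<And>v. v \<in> U \<Longrightarrow> f v = g v"
  shows "hol_Cn_at g p"
  using assms unfolding hol_Cn_at_def by (metis has_derivative_transform_within_open)

lemma hol_Cn_at_continuous: "hol_Cn_at f p \<Longrightarrow> isCont f p"
  unfolding hol_Cn_at_def using has_derivative_continuous by blast

lemma is_form_hol_Cn_at: "is_form d f \<Longrightarrow> hol_Cn_at f p"
  unfolding is_form_def
  by (auto intro!: hol_Cn_at_sum hol_Cn_at_mult hol_Cn_at_const hol_Cn_at_prod hol_Cn_at_power hol_Cn_at_coord)

lemma is_form_scale:
  assumes "is_form d f" shows "f (c *s v) = c ^ d * f v"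
proof -
  from assms obtain k :: "('a \<Rightarrow> nat) \<Rightarrow> complex" where
    f: "f = (\<lambda>v. \<Sum>m\<in>{m. (\<Sum>i\<in>UNIV. m i) = d}. k m * (\<Prod>i\<in>UNIV. (v $ i) ^ m i))"
    unfolding is_form_def by blast
  have "(\<Prod>i\<in>UNIV. ((c *s v) $ i) ^ m i) = c ^ d * (\<Prod>i\<in>UNIV. (v $ i) ^ m i)"
    if "(\<Sum>i\<in>UNIV. m i) = d" for m :: "'a \<Rightarrow> nat"
    using that by (auto simp: power_mult_distrib prod.distrib simp flip: power_sum)
  then show ?thesis unfolding f by (simp add: sum_distrib_left mult_ac)
qed

lemma finite_exponents: "finite {m :: 'n::finite \<Rightarrow> nat. (\<Sum>i\<in>UNIV. m i) = d}"
proof (rule finite_subset)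
  show "{m :: 'n \<Rightarrow> nat. (\<Sum>i\<in>UNIV. m i) = d} \<subseteq> PiE UNIV (\<lambda>_. {..d})"
  proof safe
    fix m :: "'n \<Rightarrow> nat" and i :: 'n
    show "m i \<le> (\<Sum>i\<in>UNIV. m i)" by (rule member_le_sum) auto
  qed auto
qed (auto intro: finite_PiE)

lemma is_form_coord: "is_form 1 (\<lambda>v :: complex ^ 'n. v $ i)"
proof -
  let ?e = "\<lambda>j :: 'n. if j = i then 1 else 0 :: nat"
  let ?c = "\<lambda>m. if m = ?e then 1 else 0 :: complex"
  have e: "(\<Sum>j\<in>UNIV. ?e j) = 1" by simp
  have "(\<Sum>m\<in>{m. (\<Sum>i\<in>UNIV. m i) = 1}. ?c m * (\<Prod>j\<in>UNIV. (v $ j) ^ m j)) = v $ i"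
    for v :: "complex ^ 'n"
  proof -
    have "(\<Sum>m\<in>{m. (\<Sum>i\<in>UNIV. m i) = 1}. ?c m * (\<Prod>j\<in>UNIV. (v $ j) ^ m j))
        = (\<Sum>m\<in>{m. (\<Sum>i\<in>UNIV. m i) = 1}. if m = ?e then \<Prod>j\<in>UNIV. (v $ j) ^ ?e j else 0)"
      by (intro sum.cong) auto
    also have "\<dots> = (\<Prod>j\<in>UNIV. (v $ j) ^ ?e j)"
      using e by (subst sum.delta) (auto simp: finite_exponents)
    also have "\<dots> = (\<Prod>j\<in>UNIV. if j = i then v $ j else 1)" by (intro prod.cong) auto
    finally show ?thesis by simp
  qed
  then show ?thesis unfolding is_form_def by (intro exI[of _ ?c]) auto
qed

lemma line_eq_iff: "line v = line w \<longleftrightarrow> (\<exists>c. c \<noteq> 0 \<and> w = c *s v)"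
proof
  assume "line v = line w"
  moreover have "w \<in> line w" unfolding line_def by (rule CollectI, rule exI[of _ 1]) simp
  ultimately show "\<exists>c. c \<noteq> 0 \<and> w = c *s v" by (auto simp: line_def)
next
  assume "\<exists>c. c \<noteq> 0 \<and> w = c *s v"
  then obtain c where c: "c \<noteq> 0" "w = c *s v" by blast
  show "line v = line w"
  proof (intro equalityI subsetI)
    fix x assume "x \<in> line v"
    then obtain k where "k \<noteq> 0" "x = k *s v" by (auto simp: line_def)
    then have "k / c \<noteq> 0" "x = (k / c) *s w" using c by (simp_all add: vector_smult_assoc)
    then show "x \<in> line w" unfolding line_def by blast
  next
    fix x assume "x \<in> line w"
    then obtain k where "k \<noteq> 0" "x = k *s w" by (auto simp: line_def)
    then have "k * c \<noteq> 0" "x = (k * c) *s v" using c by (simp_all add: vector_smult_assoc)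
    then show "x \<in> line v" unfolding line_def by blast
  qed
qed

lemma line_scale: "c \<noteq> 0 \<Longrightarrow> line (c *s v) = line v"
  using line_eq_iff by metis

text \<open>
  Turns an expression in homogeneous coordinates into a function on lines.
\<close>

definition line_rep :: "(complex ^ 'n) set \<Rightarrow> complex ^ 'n" where
  "line_rep l = (SOME v. v \<noteq> 0 \<and> l = line v)"

lemma line_rep_line:
  assumes "v \<noteq> 0" obtains c where "c \<noteq> 0" "line_rep (line v) = c *s v"
proof -
  have "line_rep (line v) \<noteq> 0 \<and> line v = line (line_rep (line v))"
    unfolding line_rep_def by (rule someI_ex) (use assms in auto)
  then show ?thesis using that line_eq_iff by metis
qed

abbreviation lines :: "(complex ^ 'n) set set" where "lines \<equiv> line ` (- {0})"

lemma topspace_zariski: "topspace zariski = (lines :: (complex ^ 'n) set set)"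
proof -
  let ?B = "{{line v | v. v \<noteq> 0 \<and> f v \<noteq> 0} | f. \<exists>d. is_form d f} :: (complex ^ 'n) set set set"
  have "l \<in> \<Union>?B" if "l \<in> lines" for l :: "(complex ^ 'n) set"
  proof -
    from that obtain v where v: "v \<noteq> 0" "l = line v" by blast
    then obtain i where "v $ i \<noteq> 0" by (auto simp: vec_eq_iff)
    then have "l \<in> {line v | v. v \<noteq> 0 \<and> v $ i \<noteq> 0}" using v by blast
    moreover have "{line v | v. v \<noteq> 0 \<and> v $ i \<noteq> 0} \<in> ?B"
      by (rule CollectI, rule exI[of _ "\<lambda>v. v $ i"]) (use is_form_coord in blast)
    ultimately show ?thesis by (rule UnionI[rotated])
  qed
  moreover have "\<Union>?B \<subseteq> lines" by auto
  ultimately have "\<Union>?B = lines" by blast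
  then show ?thesis by (simp add: zariski_def topology_generated_by_topspace)
qed

lemma fs_top_punctured: "fs_top (fs_sub hol_Cn (- {0})) = top_of_set (- {0})"
  by (simp add: fs_sub_def hol_Cn_def)

lemma openin_hol_proj_space:
  "openin (fs_top hol_proj_space) V \<longleftrightarrow> V \<subseteq> lines \<and> open {v. v \<noteq> 0 \<and> line v \<in> V}"
proof -
  have "open (- {0 :: complex ^ 'a})" by auto
  moreover have "{x \<in> - {0}. line x \<in> V} = {v. v \<noteq> 0 \<and> line v \<in> V}" by auto
  ultimately show ?thesis
    unfolding hol_proj_space_def openin_fs_quotient fs_top_punctured topspace_euclidean_subtopology
    by (simp add: openin_open_eq)
qed

lemma points_hol_proj_space: "points hol_proj_space = lines"
  by (simp add: hol_proj_space_def fs_top_punctured)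

lemma sections_hol_proj_space:
  assumes "openin (fs_top hol_proj_space) V"
  shows "u \<in> fs_sections hol_proj_space V \<longleftrightarrow>
    (\<forall>v. v \<noteq> 0 \<longrightarrow> line v \<in> V \<longrightarrow> hol_Cn_at (u \<circ> line) v)"
proof -
  let ?V = "{v. v \<noteq> 0 \<and> line v \<in> V}"
  have op: "open ?V" using assms by (simp add: openin_hol_proj_space)
  have eq: "{x \<in> - {0}. line x \<in> V} = ?V" by auto
  have "u \<in> fs_sections hol_proj_space V \<longleftrightarrow>
    (\<forall>p\<in>?V. \<exists>W w. open W \<and> p \<in> W \<and> (\<forall>p\<in>W. hol_Cn_at w p) \<and> (\<forall>x\<in>?V \<inter> W. (u \<circ> line) x = w x))"
    by (simp add: hol_proj_space_def fs_quotient_def fs_top_punctured eq)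
       (simp add: fs_sub_def hol_Cn_def hol_Cn_at_iff_coefficients)
  also have "\<dots> \<longleftrightarrow> (\<forall>v\<in>?V. hol_Cn_at (u \<circ> line) v)"
  proof safe
    fix v assume v: "v \<noteq> 0" "line v \<in> V" and
      "\<forall>p\<in>?V. \<exists>W w. open W \<and> p \<in> W \<and> (\<forall>p\<in>W. hol_Cn_at w p) \<and> (\<forall>x\<in>?V \<inter> W. (u \<circ> line) x = w x)"
    then obtain W w where "open W" "v \<in> W" "hol_Cn_at w v" "\<forall>x\<in>?V \<inter> W. (u \<circ> line) x = w x"
      by blast
    then show "hol_Cn_at (u \<circ> line) v"
      using hol_Cn_at_cong_open[of w v "?V \<inter> W" "u \<circ> line"] op v by auto
  next
    fix v assume "v \<noteq> 0" "line v \<in> V" "\<forall>v\<in>?V. hol_Cn_at (u \<circ> line) v"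
    then show "\<exists>W w. open W \<and> v \<in> W \<and> (\<forall>p\<in>W. hol_Cn_at w p) \<and> (\<forall>x\<in>?V \<inter> W. (u \<circ> line) x = w x)"
      using op by (intro exI[of _ ?V] exI[of _ "u \<circ> line"]) auto
  qed
  finally show ?thesis by auto
qed

lemma zariski_open_imp_hol_open:
  assumes "openin zariski U" shows "openin (fs_top hol_proj_space) U"
proof -
  have "generate_topology_on {{line v | v. v \<noteq> 0 \<and> f v \<noteq> 0} | f. \<exists>d. is_form d f} U"
    using assms by (simp add: zariski_def openin_topology_generated_by_iff)
  then show ?thesis
  proof (induction rule: generate_topology_on.induct)
    case (Basis s)
    then obtain f d where f: "is_form d f" and s: "s = {line v | v. v \<noteq> 0 \<and> f v \<noteq> 0}" by blast
    have "{v. v \<noteq> 0 \<and> line v \<in> s} = (- {0}) \<inter> (- {0}) \<inter> f -` (- {0})"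
      unfolding s by (auto simp: line_eq_iff is_form_scale[OF f])
    moreover have "continuous_on UNIV f"
      by (intro continuous_at_imp_continuous_on ballI hol_Cn_at_continuous is_form_hol_Cn_at[OF f])
    then have "open (f -` (- {0}))" by (intro open_vimage) auto
    ultimately show ?case unfolding openin_hol_proj_space using s by auto
  qed auto
qed


lemma fs_sub_simps:
  "fs_top (fs_sub X A) = subtopology (fs_top X) A"
  "u \<in> fs_sections (fs_sub X A) V \<longleftrightarrow> (\<forall>p\<in>V. \<exists>W w. openin (fs_top X) W \<and> p \<in> W \<and>
    w \<in> fs_sections X W \<and> (\<forall>x\<in>V \<inter> W. u x = w x))"
  by (simp_all add: fs_sub_def)

lemma fs_top_alg_proj_space: "fs_top alg_proj_space = zariski"
  by (simp add: alg_proj_space_def)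

lemma points_alg: "X \<subseteq> lines \<Longrightarrow> points (alg X) = X"
  by (auto simp: fs_sub_simps fs_top_alg_proj_space topspace_zariski)

lemma points_an: "X \<subseteq> lines \<Longrightarrow> points (an X) = X"
  by (auto simp: fs_sub_simps points_hol_proj_space)

text \<open>
  On the chart where the \<open>j\<close>-th coordinate does not vanish, the \<open>i\<close>-th affine coordinate is a
  regular function. Its pullback along \<open>f\<close> is regular, hence locally a quotient of forms.
\<close>

lemma alg_morphism_affine_coordinate:
  fixes f :: "(complex ^ 'm) set \<Rightarrow> (complex ^ 'n) set" and y :: "complex ^ 'n"
  assumes f: "fs_morphism (alg X) (alg Y) f" and X: "X \<subseteq> lines" and Y: "Y \<subseteq> lines"
    and p: "p \<in> X" "f p = line y" "y $ j \<noteq> 0"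
  obtains W d a b where "openin zariski W" "p \<in> W" "is_form d a" "is_form d b"
    "\<And>v. v \<noteq> 0 \<Longrightarrow> line v \<in> W \<Longrightarrow> b v \<noteq> 0"
    "\<And>v. v \<noteq> 0 \<Longrightarrow> line v \<in> X \<inter> W \<Longrightarrow> \<exists>y. f (line v) = line y \<and> y $ j = 1 \<and> y $ i = a v / b v"
proof -
  let ?D = "{line v | v :: complex ^ 'n. v \<noteq> 0 \<and> v $ j \<noteq> 0}"
  define u where "u = (\<lambda>l :: (complex ^ 'n) set. line_rep l $ i / line_rep l $ j)"
  have u: "u (line v) = v $ i / v $ j" if v: "v \<noteq> 0" for v
  proof -
    obtain c where "c \<noteq> 0" "line_rep (line v) = c *s v" using line_rep_line[OF v] .
    then show ?thesis by (simp add: u_def)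
  qed
  have "?D \<in> {{line v | v. v \<noteq> 0 \<and> f v \<noteq> 0} | f. \<exists>d. is_form d f}"
    by (rule CollectI, rule exI[of _ "\<lambda>v. v $ j"]) (use is_form_coord in blast)
  then have D: "openin zariski ?D"
    unfolding zariski_def openin_topology_generated_by_iff by (rule generate_topology_on.Basis)
  have jD: "v $ j \<noteq> 0" if "v \<noteq> 0" "line v \<in> ?D" for v :: "complex ^ 'n"
    using that by (auto simp: line_eq_iff)
  have uD: "u \<in> fs_sections alg_proj_space ?D"
    unfolding alg_proj_space_def fspace.simps
  proof (rule CollectI, rule ballI)
    fix p assume "p \<in> ?D"
    then show "\<exists>W d f g. openin zariski W \<and> p \<in> W \<and> W \<subseteq> ?D \<and> is_form d f \<and> is_form d g \<and>
      (\<forall>v. v \<noteq> 0 \<longrightarrow> line v \<in> W \<longrightarrow> g v \<noteq> 0 \<and> u (line v) = f v / g v)"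
      by (intro exI[of _ ?D] exI[of _ 1] exI[of _ "\<lambda>v. v $ i"] exI[of _ "\<lambda>v. v $ j"] conjI
          D is_form_coord allI impI) (simp_all add: u jD del: mem_Collect_eq)
  qed
  let ?V = "?D \<inter> Y"
  have "openin (fs_top (alg Y)) ?V"
    unfolding fs_sub_simps fs_top_alg_proj_space using D by (auto simp: openin_subtopology)
  moreover have "u \<in> fs_sections (alg Y) ?V"
    unfolding fs_sub_simps fs_top_alg_proj_space using D uD by blast
  ultimately have uf: "u \<circ> f \<in> fs_sections (alg X) {x \<in> X. f x \<in> ?V}"
    and opV: "openin (fs_top (alg X)) {x \<in> X. f x \<in> ?V}"
    using fs_morphism_sections[OF f] openin_continuous_map_preimage[OF fs_morphism_continuous[OF f]]
    unfolding points_alg[OF X] by blast+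
  from opV obtain W0 where W0: "openin zariski W0" "{x \<in> X. f x \<in> ?V} = W0 \<inter> X"
    unfolding fs_sub_simps fs_top_alg_proj_space openin_subtopology by blast
  have y0: "y \<noteq> 0" using p(3) by auto
  have fY: "f x \<in> Y" if "x \<in> X" for x
    using fs_morphism_points[OF f] that unfolding points_alg[OF X] points_alg[OF Y] .
  have pV: "p \<in> {x \<in> X. f x \<in> ?V}" using p fY[OF p(1)] y0 by auto
  with uf[unfolded fs_sub_simps(2) fs_top_alg_proj_space]
  have "\<exists>W w. openin zariski W \<and> p \<in> W \<and> w \<in> fs_sections alg_proj_space W \<and>
    (\<forall>x\<in>{x \<in> X. f x \<in> ?V} \<inter> W. (u \<circ> f) x = w x)" by (rule bspec)
  then obtain W1 w where W1: "openin zariski W1" "p \<in> W1" "w \<in> fs_sections alg_proj_space W1"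
    and uw: "\<forall>x\<in>{x \<in> X. f x \<in> ?V} \<inter> W1. (u \<circ> f) x = w x"
    by (elim exE conjE)
  from W1(3,2) have "\<exists>W2 d a b. openin zariski W2 \<and> p \<in> W2 \<and> W2 \<subseteq> W1 \<and> is_form d a \<and> is_form d b \<and>
    (\<forall>v. v \<noteq> 0 \<longrightarrow> line v \<in> W2 \<longrightarrow> b v \<noteq> 0 \<and> w (line v) = a v / b v)"
    unfolding alg_proj_space_def fspace.simps mem_Collect_eq by (rule bspec)
  then obtain W2 d a b where W2: "openin zariski W2" "p \<in> W2" "W2 \<subseteq> W1" "is_form d a"
    "is_form d b" "\<And>v. v \<noteq> 0 \<Longrightarrow> line v \<in> W2 \<Longrightarrow> b v \<noteq> 0 \<and> w (line v) = a v / b v"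
    by blast
  show ?thesis
  proof (rule that[of "W0 \<inter> W2" d a b])
    show "openin zariski (W0 \<inter> W2)" using W0 W2 by blast
    show "p \<in> W0 \<inter> W2" using W0 W2 pV by blast
    fix v :: "complex ^ 'm" assume v: "v \<noteq> 0"
    { assume "line v \<in> W0 \<inter> W2" then show "b v \<noteq> 0" using W2(6) v by blast }
    assume vX: "line v \<in> X \<inter> (W0 \<inter> W2)"
    then have inV: "line v \<in> {x \<in> X. f x \<in> ?V} \<inter> W1" using W0(2) W2(3) by blast
    then obtain y' where y': "y' \<noteq> 0" "y' $ j \<noteq> 0" "f (line v) = line y'" by blast
    have "y' $ i / y' $ j = a v / b v"
      using bspec[OF uw inV] W2(6)[OF v] vX u[OF y'(1)] y'(3) by simp
    moreover have "f (line v) = line ((1 / y' $ j) *s y')" using y' by (simp add: line_scale)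
    ultimately show "\<exists>y. f (line v) = line y \<and> y $ j = 1 \<and> y $ i = a v / b v"
      using y' by (intro exI[of _ "(1 / y' $ j) *s y'"]) auto
  qed (use W2 in auto)
qed

text \<open>
  The affine coordinates of \<open>f\<close> in one chart, taken together, are homogeneous coordinates of \<open>f\<close>
  that do not depend on the choice of a vector on the line.
\<close>

lemma alg_morphism_local_form:
  fixes f :: "(complex ^ 'm) set \<Rightarrow> (complex ^ 'n) set"
  assumes f: "fs_morphism (alg X) (alg Y) f" and X: "X \<subseteq> lines" and Y: "Y \<subseteq> lines" and p: "p \<in> X"
  obtains W and F :: "complex ^ 'm \<Rightarrow> complex ^ 'n" where
    "openin (fs_top hol_proj_space) W" "p \<in> W" "\<And>v. F v \<noteq> 0"
    "\<And>v i. v \<noteq> 0 \<Longrightarrow> line v \<in> W \<Longrightarrow> hol_Cn_at (\<lambda>v. F v $ i) v"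
    "\<And>v c. c \<noteq> 0 \<Longrightarrow> F (c *s v) = F v"
    "\<And>v. v \<noteq> 0 \<Longrightarrow> line v \<in> X \<inter> W \<Longrightarrow> f (line v) = line (F v)"
proof -
  have "f p \<in> Y" using fs_morphism_points[OF f] p unfolding points_alg[OF X] points_alg[OF Y] .
  then obtain y where y: "f p = line y" "y \<noteq> 0" using Y by blast
  then obtain j where j: "y $ j \<noteq> 0" by (auto simp: vec_eq_iff)
  have "\<exists>W d a b. openin zariski W \<and> p \<in> W \<and> is_form d a \<and> is_form d b \<and>
    (\<forall>v. v \<noteq> 0 \<longrightarrow> line v \<in> W \<longrightarrow> b v \<noteq> 0) \<and>
    (\<forall>v. v \<noteq> 0 \<longrightarrow> line v \<in> X \<inter> W \<longrightarrow> (\<exists>y. f (line v) = line y \<and> y $ j = 1 \<and> y $ i = a v / b v))" for i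
    by (rule alg_morphism_affine_coordinate[OF f X Y p y(1) j, of i]) blast
  then obtain W d a b where W: "\<And>i. openin zariski (W i)" "\<And>i. p \<in> W i"
    and ab: "\<And>i. is_form (d i) (a i)" "\<And>i. is_form (d i) (b i)"
    and b0: "\<And>i v. v \<noteq> 0 \<Longrightarrow> line v \<in> W i \<Longrightarrow> b i v \<noteq> 0"
    and ex: "\<And>i v. v \<noteq> 0 \<Longrightarrow> line v \<in> X \<inter> W i \<Longrightarrow>
      \<exists>y. f (line v) = line y \<and> y $ j = 1 \<and> y $ i = a i v / b i v"
    by metis
  \<comment> \<open>The quotient for \<open>i = j\<close> equals 1 only over \<open>X\<close>. The constant 1 instead makes \<open>F\<close> nonzero everywhere.\<close>
  define F where "F = (\<lambda>v. \<chi> i. if i = j then 1 else a i v / b i v)"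
  show ?thesis
  proof (rule that[of "\<Inter>i. W i" F])
    show "openin (fs_top hol_proj_space) (\<Inter>i. W i)"
      by (rule openin_INT2) (auto intro: zariski_open_imp_hol_open W)
    show "p \<in> (\<Inter>i. W i)" using W by blast
    show "F v \<noteq> 0" for v
    proof -
      have "F v $ j = 1" by (simp add: F_def)
      then show ?thesis by auto
    qed
    show "F (c *s v) = F v" if "c \<noteq> 0" for c v
      using that by (simp add: F_def vec_eq_iff is_form_scale[OF ab(1)] is_form_scale[OF ab(2)])
    fix v :: "complex ^ 'm" assume v: "v \<noteq> 0"
    show "hol_Cn_at (\<lambda>v. F v $ i) v" if "line v \<in> (\<Inter>i. W i)" for i
    proof (cases "i = j")
      case True
      then show ?thesis by (simp add: F_def hol_Cn_at_const)
    next
      case False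
      then show ?thesis using b0[OF v, of i] that
        by (auto simp: F_def intro!: hol_Cn_at_divide is_form_hol_Cn_at[OF ab(1)] is_form_hol_Cn_at[OF ab(2)])
    qed
    assume vX: "line v \<in> X \<inter> (\<Inter>i. W i)"
    then obtain y where y: "f (line v) = line y" "y $ j = 1" using ex[OF v, of j] by blast
    have "y $ i = a i v / b i v" for i
    proof -
      obtain y' where y': "f (line v) = line y'" "y' $ j = 1" "y' $ i = a i v / b i v"
        using ex[OF v, of i] vX by blast
      then obtain c where "y' = c *s y" using y line_eq_iff by metis
      then have "y' = y" using y(2) y'(2) by simp
      then show ?thesis using y'(3) by simp
    qed
    then have "F v = y" using y(2) by (simp add: F_def vec_eq_iff)
    then show "f (line v) = line (F v)" using y by simp
  qed
qed

text \<open>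
  The holomorphic homogeneous coordinates \<open>F\<close> are continuous, so \<open>W\<close> can be shrunk to the open set
  on which \<open>F\<close> takes values in \<open>V\<close>.
\<close>

lemma alg_morphism_local_form_into:
  fixes f :: "(complex ^ 'm) set \<Rightarrow> (complex ^ 'n) set"
  assumes f: "fs_morphism (alg X) (alg Y) f" and X: "X \<subseteq> lines" and Y: "Y \<subseteq> lines"
    and V: "openin (fs_top hol_proj_space) V" and p: "p \<in> X" "f p \<in> V"
  obtains W and F :: "complex ^ 'm \<Rightarrow> complex ^ 'n" where
    "openin (fs_top hol_proj_space) W" "p \<in> W" "\<And>v. F v \<noteq> 0"
    "\<And>v i. v \<noteq> 0 \<Longrightarrow> line v \<in> W \<Longrightarrow> hol_Cn_at (\<lambda>v. F v $ i) v"
    "\<And>v. v \<noteq> 0 \<Longrightarrow> F (line_rep (line v)) = F v"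
    "\<And>v. v \<noteq> 0 \<Longrightarrow> line v \<in> X \<inter> W \<Longrightarrow> f (line v) = line (F v)"
    "\<And>v. v \<noteq> 0 \<Longrightarrow> line v \<in> W \<Longrightarrow> line (F v) \<in> V"
proof -
  obtain W and F :: "complex ^ 'm \<Rightarrow> complex ^ 'n" where
    W: "openin (fs_top hol_proj_space) W" "p \<in> W" and F0: "\<And>v. F v \<noteq> 0"
    and dF: "\<And>v i. v \<noteq> 0 \<Longrightarrow> line v \<in> W \<Longrightarrow> hol_Cn_at (\<lambda>v. F v $ i) v"
    and Fc: "\<And>v c. c \<noteq> 0 \<Longrightarrow> F (c *s v) = F v"
    and fF: "\<And>v. v \<noteq> 0 \<Longrightarrow> line v \<in> X \<inter> W \<Longrightarrow> f (line v) = line (F v)"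
    using alg_morphism_local_form[OF f X Y p(1)] by blast
  let ?A = "{v. v \<noteq> 0 \<and> line v \<in> W}" and ?B = "{v. v \<noteq> 0 \<and> line v \<in> V}"
  let ?C = "?A \<inter> F -` ?B"
  let ?W = "line ` ?C"
  have opA: "open ?A" and opB: "open ?B" using W V by (simp_all add: openin_hol_proj_space)
  have "continuous_on ?A (\<lambda>v. \<chi> i. F v $ i)"
    by (intro continuous_on_vec_lambda continuous_at_imp_continuous_on ballI hol_Cn_at_continuous dF)
       auto
  then have "continuous_on ?A F" by simp
  then have opC: "open ?C" using opA opB by (rule continuous_open_preimage)
  have Wmem: "line v \<in> ?W \<longleftrightarrow> v \<in> ?C" if "v \<noteq> 0" for v
  proof
    assume "line v \<in> ?W"
    then obtain v' where "v' \<in> ?C" "line v = line v'" by blast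
    then obtain c where "c \<noteq> 0" "v' = c *s v" using line_eq_iff by metis
    then show "v \<in> ?C" using \<open>v' \<in> ?C\<close> that Fc \<open>line v = line v'\<close> by auto
  qed blast
  have "{v. v \<noteq> 0 \<and> line v \<in> ?W} = ?C" using Wmem by blast
  then have opW: "openin (fs_top hol_proj_space) ?W"
    unfolding openin_hol_proj_space using opC by auto
  obtain v where v: "v \<noteq> 0" "p = line v" using X p(1) by blast
  have "p \<in> ?W" unfolding v(2) Wmem[OF v(1)] using v W p fF[OF v(1)] F0 by auto
  moreover have "F (line_rep (line v)) = F v" if v: "v \<noteq> 0" for v
    using line_rep_line[OF v] Fc by metis
  moreover have "line v \<in> W" "line (F v) \<in> V" if "v \<noteq> 0" "line v \<in> ?W" for v
    using Wmem that by blast+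
  ultimately show ?thesis using dF fF F0 opW by (intro that[of ?W F]) blast+
qed

text \<open>
  Functoriality of the associated complex space. Both conditions on a morphism are local on the
  source, and locally \<open>f\<close> is the restriction of the map of an open set of the projective space that
  is given by the holomorphic homogeneous coordinates \<open>F\<close>.
\<close>

theorem alg_morphism_imp_an_morphism:
  fixes f :: "(complex ^ 'm) set \<Rightarrow> (complex ^ 'n) set"
  assumes f: "fs_morphism (alg X) (alg Y) f" and X: "X \<subseteq> lines" and Y: "Y \<subseteq> lines"
  shows "fs_morphism (an X) (an Y) f"
proof -
  have fY: "f x \<in> Y" if "x \<in> X" for x
    using fs_morphism_points[OF f] that unfolding points_alg[OF X] points_alg[OF Y] .
  show ?thesis
  proof (rule fs_morphismI)
    show "continuous_map (fs_top (an X)) (fs_top (an Y)) f"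
      unfolding continuous_map_def points_an[OF X] points_an[OF Y]
    proof (intro conjI allI impI)
      show "f \<in> X \<rightarrow> Y" using fY by blast
      fix V assume "openin (fs_top (an Y)) V"
      then obtain V' where V': "openin (fs_top hol_proj_space) V'" "V = V' \<inter> Y"
        unfolding fs_sub_simps openin_subtopology by blast
      show "openin (fs_top (an X)) {x \<in> X. f x \<in> V}"
      proof (subst openin_subopen, rule ballI)
        fix p assume p: "p \<in> {x \<in> X. f x \<in> V}"
        then have pV: "p \<in> X" "f p \<in> V'" using V' by auto
        obtain W and F :: "complex ^ 'm \<Rightarrow> complex ^ 'n" where W: "openin (fs_top hol_proj_space) W" "p \<in> W"
        and F0: "\<And>v. F v \<noteq> 0"
        and dF: "\<And>v i. v \<noteq> 0 \<Longrightarrow> line v \<in> W \<Longrightarrow> hol_Cn_at (\<lambda>v. F v $ i) v"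
        and Fr: "\<And>v. v \<noteq> 0 \<Longrightarrow> F (line_rep (line v)) = F v"
        and fF: "\<And>v. v \<noteq> 0 \<Longrightarrow> line v \<in> X \<inter> W \<Longrightarrow> f (line v) = line (F v)"
        and FV: "\<And>v. v \<noteq> 0 \<Longrightarrow> line v \<in> W \<Longrightarrow> line (F v) \<in> V'"
        using alg_morphism_local_form_into[OF f X Y V'(1) pV] by blast
        have "X \<inter> W \<subseteq> {x \<in> X. f x \<in> V}"
        proof
          fix x assume x: "x \<in> X \<inter> W"
          then obtain v where v: "v \<noteq> 0" "x = line v" using X by blast
          then show "x \<in> {x \<in> X. f x \<in> V}" using fF[OF v(1)] FV[OF v(1)] x fY[of x] V'(2) by auto
        qed
        moreover have "openin (fs_top (an X)) (X \<inter> W)"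
          unfolding fs_sub_simps using W by (metis Int_commute openin_subtopology)
        ultimately show "\<exists>T. openin (fs_top (an X)) T \<and> p \<in> T \<and> T \<subseteq> {x \<in> X. f x \<in> V}"
          using pV W by blast
      qed
    qed
    fix V u assume V: "openin (fs_top (an Y)) V" and u: "u \<in> fs_sections (an Y) V"
    show "u \<circ> f \<in> fs_sections (an X) {x \<in> points (an X). f x \<in> V}"
      unfolding fs_sub_simps(2) points_an[OF X]
    proof
      fix p assume p: "p \<in> {x \<in> X. f x \<in> V}"
      then have "f p \<in> V" by simp
      with u[unfolded fs_sub_simps(2)] have "\<exists>W w. openin (fs_top hol_proj_space) W \<and> f p \<in> W \<and>
        w \<in> fs_sections hol_proj_space W \<and> (\<forall>x\<in>V \<inter> W. u x = w x)" by (rule bspec)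
      then obtain V' w where V': "openin (fs_top hol_proj_space) V'" "f p \<in> V'"
        and w: "w \<in> fs_sections hol_proj_space V'" "\<And>y. y \<in> V \<inter> V' \<Longrightarrow> u y = w y"
        by blast
      from p V' have pV: "p \<in> X" "f p \<in> V'" by auto
      obtain W and F :: "complex ^ 'm \<Rightarrow> complex ^ 'n" where W: "openin (fs_top hol_proj_space) W" "p \<in> W"
        and F0: "\<And>v. F v \<noteq> 0"
        and dF: "\<And>v i. v \<noteq> 0 \<Longrightarrow> line v \<in> W \<Longrightarrow> hol_Cn_at (\<lambda>v. F v $ i) v"
        and Fr: "\<And>v. v \<noteq> 0 \<Longrightarrow> F (line_rep (line v)) = F v"
        and fF: "\<And>v. v \<noteq> 0 \<Longrightarrow> line v \<in> X \<inter> W \<Longrightarrow> f (line v) = line (F v)"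
        and FV: "\<And>v. v \<noteq> 0 \<Longrightarrow> line v \<in> W \<Longrightarrow> line (F v) \<in> V'"
        using alg_morphism_local_form_into[OF f X Y V'(1) pV] by blast
      define w' where "w' = (\<lambda>l. w (line (F (line_rep l))))"
      have w': "w' (line v) = (w \<circ> line) (F v)" if "v \<noteq> 0" for v
        by (simp add: w'_def Fr[OF that])
      have "w' \<in> fs_sections hol_proj_space W"
        unfolding sections_hol_proj_space[OF W(1)]
      proof (intro allI impI)
        fix v :: "complex ^ 'm" assume v: "v \<noteq> 0" "line v \<in> W"
        have "hol_Cn_at (w \<circ> line) (F v)"
          using w(1) F0 FV[OF v] unfolding sections_hol_proj_space[OF V'(1)] by blast
        from hol_Cn_at_compose[OF this dF[OF v]]
        have "hol_Cn_at (\<lambda>v. (w \<circ> line) (F v)) v" .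
        then show "hol_Cn_at (w' \<circ> line) v"
          by (rule hol_Cn_at_cong_open[of _ _ "- {0}"]) (use v w' in auto)
      qed
      moreover have "(u \<circ> f) x = w' x" if x: "x \<in> {x \<in> X. f x \<in> V} \<inter> W" for x
      proof -
        obtain v where v: "v \<noteq> 0" "x = line v" using X x by blast
        then show ?thesis using x fF[OF v(1)] FV[OF v(1)] w(2) w'[OF v(1)] by auto
      qed
      ultimately show "\<exists>W w. openin (fs_top hol_proj_space) W \<and> p \<in> W \<and>
          w \<in> fs_sections hol_proj_space W \<and> (\<forall>x\<in>{x \<in> X. f x \<in> V} \<inter> W. (u \<circ> f) x = w x)"
        by (intro exI[of _ W] exI[of _ w'] conjI ballI W)
    qed
  qed
qed

section \<open>Lifting holomorphic maps along coverings by the plane\<close>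

definition hol_C2_at :: "(complex \<times> complex \<Rightarrow> complex) \<Rightarrow> complex \<times> complex \<Rightarrow> bool" where
  "hol_C2_at f p \<longleftrightarrow> (\<exists>a b. (f has_derivative (\<lambda>(v, w). a * v + b * w)) (at p))"

lemma hol_C2_simps:
  "fs_top hol_C2 = euclidean" "u \<in> fs_sections hol_C2 U \<longleftrightarrow> (\<forall>p\<in>U. hol_C2_at u p)"
  by (simp_all add: hol_C2_def hol_C2_at_def)

lemma hol_C2_at_cong_open:
  assumes "hol_C2_at f p" "open U" "p \<in> U" "\<And>v. v \<in> U \<Longrightarrow> f v = g v"
  shows "hol_C2_at g p"
proof -
  obtain a b where "(f has_derivative (\<lambda>(v, w). a * v + b * w)) (at p)"
    using assms(1) unfolding hol_C2_at_def by blast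
  from has_derivative_transform_within_open[OF this assms(2,3,4)]
  show ?thesis unfolding hol_C2_at_def by blast
qed

lemma hol_C2_at_fst: "hol_C2_at fst p"
  unfolding hol_C2_at_def
  by (intro exI[of _ 1] exI[of _ 0]) (auto intro!: derivative_eq_intros simp: fun_eq_iff)

lemma hol_C2_at_snd: "hol_C2_at snd p"
  unfolding hol_C2_at_def
  by (intro exI[of _ 0] exI[of _ 1]) (auto intro!: derivative_eq_intros simp: fun_eq_iff)

lemma hol_C2_at_affine:
  assumes "hol_C2_at f p" shows "hol_C2_at (\<lambda>x. k * f x + c) p"
proof -
  obtain a b where "(f has_derivative (\<lambda>(v, w). a * v + b * w)) (at p)"
    using assms(1) unfolding hol_C2_at_def by blast
  then have "((\<lambda>x. k * f x + c) has_derivative (\<lambda>h. k * (case h of (v, w) \<Rightarrow> a * v + b * w))) (at p)"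
    by (auto intro!: derivative_eq_intros)
  moreover have "(\<lambda>h. k * (case h of (v, w) \<Rightarrow> a * v + b * w)) = (\<lambda>(v, w). (k * a) * v + (k * b) * w)"
    by (auto simp: fun_eq_iff algebra_simps)
  ultimately show ?thesis unfolding hol_C2_at_def by metis
qed

lemma hol_C2_at_continuous: "hol_C2_at f p \<Longrightarrow> isCont f p"
  unfolding hol_C2_at_def using has_derivative_continuous by blast

text \<open>
  Restriction to complex lines makes Liouville's theorem available in the plane.
\<close>

lemma hol_C2_at_on_line:
  assumes "hol_C2_at f (b1 + t * a1, b2 + t * a2)"
  shows "(\<lambda>t. f (b1 + t * a1, b2 + t * a2)) field_differentiable at t"
proof -
  obtain a b where *: "(f has_derivative (\<lambda>(v, w). a * v + b * w)) (at (b1 + t * a1, b2 + t * a2))"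
    using assms(1) unfolding hol_C2_at_def by blast
  have "((\<lambda>t. (b1 + t * a1, b2 + t * a2)) has_derivative (\<lambda>h. (h * a1, h * a2))) (at t)"
    by (auto intro!: derivative_eq_intros)
  from has_derivative_compose[OF this *]
  have "((\<lambda>t. f (b1 + t * a1, b2 + t * a2)) has_derivative (\<lambda>h. (a * a1 + b * a2) * h)) (at t)"
    by (simp add: algebra_simps)
  then show ?thesis
    unfolding field_differentiable_def has_field_derivative_def by blast
qed

text \<open>
  A group of screw motions that acts with displacement at least \<open>\<delta>\<close>, and a map \<open>q\<close> whose fibres are
  its orbits. The uniform bound gives both the freeness and the discreteness of the action.
\<close>

locale screw_covering =
  fixes \<Gamma> :: "(complex \<times> complex \<Rightarrow> complex \<times> complex) set"
    and \<delta> :: real and q :: "complex \<times> complex \<Rightarrow> 's"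
  assumes id_in: "id \<in> \<Gamma>"
    and comp_in: "\<gamma> \<in> \<Gamma> \<Longrightarrow> \<gamma>' \<in> \<Gamma> \<Longrightarrow> \<gamma> \<circ> \<gamma>' \<in> \<Gamma>"
    and inverse_in: "\<gamma> \<in> \<Gamma> \<Longrightarrow> \<exists>\<gamma>'\<in>\<Gamma>. \<gamma>' \<circ> \<gamma> = id"
    and screw: "\<gamma> \<in> \<Gamma> \<Longrightarrow> \<exists>l \<zeta> t. cmod \<zeta> = 1 \<and> \<gamma> = (\<lambda>(z, w). (z + l, \<zeta> * w + t))"
    and delta_pos: "\<delta> > 0"
    and displacement: "\<gamma> \<in> \<Gamma> \<Longrightarrow> \<gamma> \<noteq> id \<Longrightarrow> dist (\<gamma> x) x \<ge> \<delta>"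
    and q_eq_iff: "q x = q y \<longleftrightarrow> (\<exists>\<gamma>\<in>\<Gamma>. y = \<gamma> x)"
begin

lemma isometry:
  assumes "\<gamma> \<in> \<Gamma>" shows "dist (\<gamma> x) (\<gamma> y) = dist x y"
proof -
  obtain l \<zeta> t where \<gamma>: "cmod \<zeta> = 1" "\<gamma> = (\<lambda>(z, w). (z + l, \<zeta> * w + t))"
    using screw[OF assms] by blast
  have "cmod (\<zeta> * snd x + t - (\<zeta> * snd y + t)) = cmod (snd x - snd y)"
    using \<gamma>(1) by (metis add_diff_cancel_right mult_1 norm_mult right_diff_distrib)
  then show ?thesis
    by (cases x; cases y) (simp add: \<gamma>(2) dist_prod_def dist_norm)
qed

lemma continuous_deck: "\<gamma> \<in> \<Gamma> \<Longrightarrow> continuous_on UNIV \<gamma>"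
  unfolding continuous_on_iff by (metis isometry)

lemma q_deck: "\<gamma> \<in> \<Gamma> \<Longrightarrow> q (\<gamma> x) = q x"
  using q_eq_iff by metis

lemma q_eq_near:
  assumes "q x = q y" "dist x y < \<delta>" shows "x = y"
proof -
  obtain \<gamma> where \<gamma>: "\<gamma> \<in> \<Gamma>" "y = \<gamma> x" using assms(1) q_eq_iff by blast
  then have "\<gamma> = id" using displacement[OF \<gamma>(1), of x] assms(2) by (fastforce simp: dist_commute)
  then show ?thesis using \<gamma> by simp
qed

lemma deck_eq:
  assumes "\<gamma> \<in> \<Gamma>" "\<gamma>' \<in> \<Gamma>" "\<gamma> x = \<gamma>' x" shows "\<gamma> = \<gamma>'"
proof -
  obtain \<beta> where \<beta>: "\<beta> \<in> \<Gamma>" "\<beta> \<circ> \<gamma>' = id" using inverse_in[OF assms(2)] by blast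
  obtain \<beta>' where \<beta>': "\<beta>' \<in> \<Gamma>" "\<beta>' \<circ> \<beta> = id" using inverse_in[OF \<beta>(1)] by blast
  have "\<beta>' = \<gamma>'" using \<beta> \<beta>' by (metis comp_assoc comp_id id_comp)
  have "(\<beta> \<circ> \<gamma>) x = x" using assms(3) \<beta>(2) by (metis comp_apply id_apply)
  then have "\<beta> \<circ> \<gamma> = id" using displacement[OF comp_in[OF \<beta>(1) assms(1)], of x] delta_pos by auto
  then have "\<gamma> = \<beta>'" using \<beta>'(2) by (metis comp_assoc comp_id id_comp)
  then show ?thesis using \<open>\<beta>' = \<gamma>'\<close> by simp
qed

abbreviation "surface \<equiv> fs_quotient hol_C2 q"

lemma openin_surface: "openin (fs_top surface) V \<longleftrightarrow> V \<subseteq> range q \<and> open (q -` V)"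
  by (simp add: fs_quotient_def openin_quotient_top hol_C2_simps vimage_def)

lemma sections_surface: "u \<in> fs_sections surface V \<longleftrightarrow> (\<forall>p. q p \<in> V \<longrightarrow> hol_C2_at (u \<circ> q) p)"
  by (simp add: fs_quotient_def hol_C2_simps)

lemma open_image:
  assumes "open U" shows "openin (fs_top surface) (q ` U)"
proof -
  have "q -` q ` U = (\<Union>\<gamma>\<in>\<Gamma>. \<gamma> -` U)"
  proof (intro equalityI subsetI)
    fix x assume "x \<in> q -` q ` U"
    then obtain u where "u \<in> U" "q x = q u" by blast
    then obtain \<gamma> where "\<gamma> \<in> \<Gamma>" "u = \<gamma> x" using q_eq_iff[of x u] by auto
    then show "x \<in> (\<Union>\<gamma>\<in>\<Gamma>. \<gamma> -` U)" using \<open>u \<in> U\<close> by blast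
  next
    fix x assume "x \<in> (\<Union>\<gamma>\<in>\<Gamma>. \<gamma> -` U)"
    then obtain \<gamma> where "\<gamma> \<in> \<Gamma>" "\<gamma> x \<in> U" by blast
    then show "x \<in> q -` q ` U" using q_deck[of \<gamma> x] by (metis imageI vimageI)
  qed
  moreover have "open (\<gamma> -` U)" if "\<gamma> \<in> \<Gamma>" for \<gamma>
    using continuous_deck[OF that] assms by (simp add: open_vimage)
  ultimately show ?thesis unfolding openin_surface by auto
qed

text \<open>
  The map \<open>q\<close> is injective on balls of radius \<open>\<delta> / 2\<close>, and its inverse there is holomorphic because
  its composition with \<open>q\<close> is a screw motion on each translate of the ball.
\<close>

lemma local_lift:
  assumes f: "fs_morphism hol_C2 surface f"
  obtains U s where "open U" "v0 \<in> U" "\<And>v. v \<in> U \<Longrightarrow> q (s v) = f v"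
    "\<And>v. v \<in> U \<Longrightarrow> hol_C2_at (fst \<circ> s) v" "\<And>v. v \<in> U \<Longrightarrow> hol_C2_at (snd \<circ> s) v"
proof -
  have "f v0 \<in> points surface"
    using f by (auto simp: fs_morphism_def continuous_map_def hol_C2_simps)
  then obtain y0 where y0: "f v0 = q y0"
    by (auto simp: fs_quotient_def topspace_quotient_top)
  define B where "B = ball y0 (\<delta> / 2)"
  have inj: "x = y" if "x \<in> B" "y \<in> B" "q x = q y" for x y
  proof -
    have "dist x y < \<delta>" using that(1,2) unfolding B_def by (metis dist_commute dist_triangle_half_l mem_ball)
    then show ?thesis using q_eq_near that(3) by blast
  qed
  define r where "r = (\<lambda>p. THE y. y \<in> B \<and> q y = p)"
  have r: "r (q y) = y" if "y \<in> B" for y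
    unfolding r_def by (rule the_equality) (use that inj in auto)
  have V: "openin (fs_top surface) (q ` B)" by (rule open_image) (simp add: B_def)
  have rq: "\<exists>\<gamma>\<in>\<Gamma>. \<exists>W. open W \<and> x \<in> W \<and> (\<forall>x'\<in>W. r (q x') = \<gamma> x')" if "q x \<in> q ` B" for x
  proof -
    from that obtain y where "y \<in> B" "q x = q y" by blast
    then obtain \<gamma> where \<gamma>: "\<gamma> \<in> \<Gamma>" "\<gamma> x \<in> B" using q_eq_iff[of x y] by auto
    have "open (\<gamma> -` B)" using continuous_deck[OF \<gamma>(1)] by (simp add: open_vimage B_def)
    moreover have "r (q x') = \<gamma> x'" if "x' \<in> \<gamma> -` B" for x'
      using that r q_deck[OF \<gamma>(1)] by (metis vimage_eq)
    ultimately show ?thesis using \<gamma> by blast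
  qed
  have rsec: "hol_C2_at (fst \<circ> r \<circ> q) x \<and> hol_C2_at (snd \<circ> r \<circ> q) x" if "q x \<in> q ` B" for x
  proof -
    from that obtain \<gamma> W where \<gamma>: "\<gamma> \<in> \<Gamma>" and W: "open W" "x \<in> W" "\<forall>x'\<in>W. r (q x') = \<gamma> x'"
      using rq by blast
    obtain l \<zeta> t where \<gamma>': "\<gamma> = (\<lambda>(z, w). (z + l, \<zeta> * w + t))"
      using screw[OF \<gamma>] by blast
    have "hol_C2_at (fst \<circ> r \<circ> q) x"
      by (rule hol_C2_at_cong_open[OF hol_C2_at_affine[OF hol_C2_at_fst, of 1 l] W(1,2)])
         (use W(3) in \<open>simp add: \<gamma>' split: prod.split\<close>)
    moreover have "hol_C2_at (snd \<circ> r \<circ> q) x"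
      by (rule hol_C2_at_cong_open[OF hol_C2_at_affine[OF hol_C2_at_snd, of \<zeta> t] W(1,2)])
         (use W(3) in \<open>simp add: \<gamma>' split: prod.split\<close>)
    ultimately show ?thesis ..
  qed
  then have sec: "fst \<circ> r \<in> fs_sections surface (q ` B)" "snd \<circ> r \<in> fs_sections surface (q ` B)"
    unfolding sections_surface by blast+
  let ?U = "{x. f x \<in> q ` B}"
  have pts: "{x \<in> points hol_C2. f x \<in> q ` B} = ?U" by (simp add: hol_C2_simps)
  show ?thesis
  proof (rule that)
    have "openin (fs_top hol_C2) ?U"
      using openin_continuous_map_preimage[OF fs_morphism_continuous[OF f] V] by (simp only: pts)
    then show "open ?U" by (simp only: hol_C2_simps(1) open_openin)
    show "v0 \<in> ?U" using y0 delta_pos by (simp add: B_def)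
    fix v assume v: "v \<in> ?U"
    then obtain y where "y \<in> B" "f v = q y" by blast
    then show "q ((r \<circ> f) v) = f v" by (simp add: r)
    have "fst \<circ> r \<circ> f \<in> fs_sections hol_C2 ?U" "snd \<circ> r \<circ> f \<in> fs_sections hol_C2 ?U"
      using fs_morphism_sections[OF f V sec(1)] fs_morphism_sections[OF f V sec(2)]
      by (simp_all only: pts)
    with v show "hol_C2_at (fst \<circ> (r \<circ> f)) v" "hol_C2_at (snd \<circ> (r \<circ> f)) v"
      unfolding hol_C2_simps(2) comp_assoc by (blast dest: bspec)+
  qed
qed

text \<open>
  Lifts that agree at a point stay closer than \<open>\<delta>\<close> near this point, where they have to coincide.
\<close>

lemma lift_eq_open:
  assumes "open U" "v0 \<in> U" "continuous_on U g" "continuous_on U g'"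
    "\<And>v. v \<in> U \<Longrightarrow> q (g v) = q (g' v)" "g v0 = g' v0"
  obtains W where "open W" "v0 \<in> W" "W \<subseteq> U" "\<And>v. v \<in> W \<Longrightarrow> g v = g' v"
proof -
  have "continuous_on U (\<lambda>v. dist (g v) (g' v))" using assms by (intro continuous_intros)
  then have "open (U \<inter> (\<lambda>v. dist (g v) (g' v)) -` {..<\<delta>})"
    using assms(1) by (intro continuous_open_preimage) auto
  then show ?thesis
  proof (rule that)
    fix v assume "v \<in> U \<inter> (\<lambda>v. dist (g v) (g' v)) -` {..<\<delta>}"
    then show "g v = g' v" using q_eq_near[of "g v" "g' v"] assms(5) by simp
  qed (use assms delta_pos in auto)
qed

text \<open>
  Once \<open>\<gamma>\<close> is chosen to match the two lifts at one point, the distance of \<open>\<gamma> \<circ> g\<close> and \<open>g'\<close> is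
  everywhere either \<open>0\<close> or at least \<open>\<delta>\<close>, so that the set of agreement is open and closed.
\<close>

lemma lift_unique:
  fixes g g' :: "complex \<times> complex \<Rightarrow> complex \<times> complex"
  assumes g: "continuous_on UNIV g" "continuous_on UNIV g'" "\<And>v. q (g v) = q (g' v)"
  obtains \<gamma> where "\<gamma> \<in> \<Gamma>" "\<And>v. g' v = \<gamma> (g v)"
proof -
  obtain \<gamma> where \<gamma>: "\<gamma> \<in> \<Gamma>" "g' 0 = \<gamma> (g 0)" using g(3)[of 0] q_eq_iff by blast
  let ?d = "\<lambda>v. dist (\<gamma> (g v)) (g' v)"
  have cd: "continuous_on UNIV ?d"
    by (intro continuous_on_dist g continuous_on_compose2[OF continuous_deck[OF \<gamma>(1)] g(1)]) auto
  have eq: "\<gamma> (g v) = g' v" if "?d v < \<delta>" for v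
    using q_eq_near[OF _ that] q_deck[OF \<gamma>(1)] g(3) by simp
  have "{v. ?d v < \<delta>} = {v. ?d v \<le> 0}" using eq delta_pos by force
  moreover have "open {v. ?d v < \<delta>}" by (intro open_Collect_less cd continuous_on_const)
  moreover have "closed {v. ?d v \<le> 0}" by (intro closed_Collect_le cd continuous_on_const)
  ultimately have "{v. ?d v < \<delta>} = {} \<or> {v. ?d v < \<delta>} = UNIV" using clopen[of "{v. ?d v < \<delta>}"] by simp
  moreover have "0 \<in> {v. ?d v < \<delta>}" using \<gamma>(2) delta_pos by simp
  ultimately have "?d v < \<delta>" for v by blast
  then show ?thesis using that[OF \<gamma>(1)] eq by metis
qed

text \<open>
  The sections of the fibre product of \<open>f\<close> and \<open>q\<close> are the lifts of \<open>f\<close>. In contrast to \<open>q\<close>, its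
  projection to the plane is a covering between subsets of normed spaces. The sheets are the graphs
  of \<open>\<gamma> \<circ> s\<close> for a local lift \<open>s\<close>.
\<close>

lemma pullback_covering:
  assumes f: "fs_morphism hol_C2 surface f"
  shows "covering_space {(v, y). q y = f v} fst UNIV"
proof (rule covering_spaceI)
  let ?X = "{(v, y). q y = f v}"
  show "continuous_on ?X fst" by (intro continuous_intros)
  show "fst ` ?X = UNIV"
  proof -
    have "\<exists>y. q y = f v" for v using local_lift[OF f, of v] by metis
    then show ?thesis by (force simp: image_iff)
  qed
  fix v0
  obtain U s where U: "open U" "v0 \<in> U" and s: "\<And>v. v \<in> U \<Longrightarrow> q (s v) = f v"
    and hol: "\<And>v. v \<in> U \<Longrightarrow> hol_C2_at (fst \<circ> s) v" "\<And>v. v \<in> U \<Longrightarrow> hol_C2_at (snd \<circ> s) v"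
    using local_lift[OF f, of v0] by metis
  have "continuous_on U (\<lambda>v. ((fst \<circ> s) v, (snd \<circ> s) v))"
    by (intro continuous_on_Pair continuous_at_imp_continuous_on ballI hol_C2_at_continuous hol)
  then have cs: "continuous_on U s" by simp
  have c\<gamma>s: "continuous_on U (\<lambda>v. \<gamma> (s v))" if "\<gamma> \<in> \<Gamma>" for \<gamma>
    by (rule continuous_on_compose2[OF continuous_deck[OF that] cs]) auto
  let ?sheet = "\<lambda>\<gamma>. (\<lambda>v. (v, \<gamma> (s v))) ` U"
  have un: "\<Union>(?sheet ` \<Gamma>) = ?X \<inter> fst -` U"
  proof (intro equalityI subsetI)
    fix x assume "x \<in> \<Union>(?sheet ` \<Gamma>)"
    then obtain \<gamma> v where "\<gamma> \<in> \<Gamma>" "v \<in> U" "x = (v, \<gamma> (s v))" by blast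
    then show "x \<in> ?X \<inter> fst -` U" using q_deck[of \<gamma>] s[of v] by simp
  next
    fix x assume "x \<in> ?X \<inter> fst -` U"
    then obtain v y where x: "x = (v, y)" "v \<in> U" "q y = f v" by auto
    then obtain \<gamma> where "\<gamma> \<in> \<Gamma>" "y = \<gamma> (s v)" using s q_eq_iff by metis
    then show "x \<in> \<Union>(?sheet ` \<Gamma>)" using x by blast
  qed
  have op: "openin (top_of_set ?X) (?sheet \<gamma>)" if \<gamma>: "\<gamma> \<in> \<Gamma>" for \<gamma>
  proof -
    let ?N = "(U \<times> UNIV) \<inter> (\<lambda>x. dist (snd x) (\<gamma> (s (fst x)))) -` {..<\<delta>}"
    have "continuous_on (U \<times> UNIV) (\<lambda>x. dist (snd x) (\<gamma> (s (fst x))))"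
      by (intro continuous_intros continuous_on_compose2[OF c\<gamma>s[OF \<gamma>]]) auto
    then have "open ?N" using U(1) by (intro continuous_open_preimage open_Times) auto
    moreover have "?sheet \<gamma> = ?X \<inter> ?N"
    proof (intro equalityI subsetI)
      fix x assume "x \<in> ?sheet \<gamma>"
      then obtain v where "v \<in> U" "x = (v, \<gamma> (s v))" by blast
      then show "x \<in> ?X \<inter> ?N" using q_deck[OF \<gamma>] s[of v] delta_pos by simp
    next
      fix x assume "x \<in> ?X \<inter> ?N"
      then obtain v y where x: "x = (v, y)" "v \<in> U" "q y = f v" "dist y (\<gamma> (s v)) < \<delta>" by auto
      then have "y = \<gamma> (s v)" using q_eq_near q_deck[OF \<gamma>] s by metis
      then show "x \<in> ?sheet \<gamma>" using x by blast
    qed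
    ultimately show ?thesis by (auto simp: openin_open)
  qed
  have dj: "pairwise disjnt (?sheet ` \<Gamma>)"
  proof (rule pairwiseI)
    fix A B assume "A \<in> ?sheet ` \<Gamma>" "B \<in> ?sheet ` \<Gamma>" and ne: "A \<noteq> B"
    then obtain \<gamma> \<gamma>' where \<gamma>: "\<gamma> \<in> \<Gamma>" "\<gamma>' \<in> \<Gamma>" and AB: "A = ?sheet \<gamma>" "B = ?sheet \<gamma>'" by blast
    show "disjnt A B"
    proof (rule ccontr)
      assume "\<not> disjnt A B"
      then obtain x where "x \<in> ?sheet \<gamma>" "x \<in> ?sheet \<gamma>'" unfolding disjnt_iff AB by blast
      then obtain v v' where "x = (v, \<gamma> (s v))" "x = (v', \<gamma>' (s v'))" by blast
      then have "\<gamma> (s v) = \<gamma>' (s v)" by (metis prod.inject)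
      then show False using deck_eq[OF \<gamma>] ne AB by blast
    qed
  qed
  have hm: "\<exists>k. homeomorphism (?sheet \<gamma>) U fst k" if \<gamma>: "\<gamma> \<in> \<Gamma>" for \<gamma>
    by (rule exI[of _ "\<lambda>v. (v, \<gamma> (s v))"], rule homeomorphismI)
       (auto intro!: continuous_intros c\<gamma>s[OF \<gamma>])
  have opU: "openin (top_of_set UNIV) U" using U(1) by simp
  have op': "\<forall>u\<in>?sheet ` \<Gamma>. openin (top_of_set ?X) u" using op by blast
  have hm': "\<forall>u\<in>?sheet ` \<Gamma>. \<exists>k. homeomorphism u U fst k" using hm by blast
  show "\<exists>T. v0 \<in> T \<and> openin (top_of_set UNIV) T \<and>
         (\<exists>v. \<Union>v = ?X \<inter> fst -` T \<and> (\<forall>u\<in>v. openin (top_of_set ?X) u) \<and> pairwise disjnt v \<and>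
              (\<forall>u\<in>v. \<exists>k. homeomorphism u T fst k))"
    by (rule exI[of _ U], intro conjI exI[of _ "?sheet ` \<Gamma>"]) fact+
qed

text \<open>
  The plane is simply connected, so the identity lifts to a section of the fibre product. The
  continuous lift \<open>g\<close> obtained this way agrees near each point with a local lift moved by a screw
  motion, hence it is holomorphic.
\<close>

theorem holomorphic_lift:
  assumes f: "fs_morphism hol_C2 surface f"
  obtains g where "\<And>v. q (g v) = f v" "\<And>v. hol_C2_at (fst \<circ> g) v" "\<And>v. hol_C2_at (snd \<circ> g) v"
proof -
  obtain G where G: "continuous_on UNIV G" "G \<in> UNIV \<rightarrow> {(v, y). q y = f v}" "\<And>v. fst (G v) = v"
    by (rule covering_space_lift[OF pullback_covering[OF f], of UNIV "\<lambda>v. v"])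
       (auto simp: convex_imp_simply_connected convex_imp_locally_path_connected)
  define g where "g = snd \<circ> G"
  have qg: "q (g v) = f v" for v
  proof -
    have "G v \<in> {(v, y). q y = f v}" using Pi_mem[OF G(2) UNIV_I] .
    then show ?thesis using G(3)[of v] by (simp add: g_def case_prod_unfold)
  qed
  have cg: "continuous_on UNIV g" unfolding g_def comp_def by (intro continuous_intros G)
  have "hol_C2_at (fst \<circ> g) v0 \<and> hol_C2_at (snd \<circ> g) v0" for v0
  proof -
    obtain U s where U: "open U" "v0 \<in> U" and s: "\<And>v. v \<in> U \<Longrightarrow> q (s v) = f v"
      and hol: "\<And>v. v \<in> U \<Longrightarrow> hol_C2_at (fst \<circ> s) v" "\<And>v. v \<in> U \<Longrightarrow> hol_C2_at (snd \<circ> s) v"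
      using local_lift[OF f, of v0] by metis
    have "continuous_on U (\<lambda>v. ((fst \<circ> s) v, (snd \<circ> s) v))"
      by (intro continuous_on_Pair continuous_at_imp_continuous_on ballI hol_C2_at_continuous hol)
    then have cs: "continuous_on U s" by simp
    obtain \<gamma> where \<gamma>: "\<gamma> \<in> \<Gamma>" "g v0 = \<gamma> (s v0)" using s[OF U(2)] qg[of v0] q_eq_iff by metis
    have "continuous_on U (\<lambda>v. \<gamma> (s v))"
      by (rule continuous_on_compose2[OF continuous_deck[OF \<gamma>(1)] cs]) auto
    moreover have "continuous_on U g" using cg continuous_on_subset by blast
    ultimately obtain W where W: "open W" "v0 \<in> W" "W \<subseteq> U" "\<And>v. v \<in> W \<Longrightarrow> \<gamma> (s v) = g v"
      using lift_eq_open[OF U, of "\<lambda>v. \<gamma> (s v)" g] s qg q_deck[OF \<gamma>(1)] \<gamma>(2) by metis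
    obtain l \<zeta> t where \<gamma>': "\<gamma> = (\<lambda>(z, w). (z + l, \<zeta> * w + t))"
      using screw[OF \<gamma>(1)] by blast
    show ?thesis
    proof
      show "hol_C2_at (fst \<circ> g) v0"
        by (rule hol_C2_at_cong_open[OF hol_C2_at_affine[OF hol(1)[OF U(2)], of 1 l] W(1,2)])
           (use W(4) in \<open>auto simp: \<gamma>' split: prod.splits simp flip: W(4)\<close>)
      show "hol_C2_at (snd \<circ> g) v0"
        by (rule hol_C2_at_cong_open[OF hol_C2_at_affine[OF hol(2)[OF U(2)], of \<zeta> t] W(1,2)])
           (use W(4) in \<open>auto simp: \<gamma>' split: prod.splits simp flip: W(4)\<close>)
    qed
  qed
  then show ?thesis using that qg by blast
qed

text \<open>
  Shifting the argument by a period composes \<open>g\<close> with an isometry. Therefore the distance of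
  \<open>g (v + h)\<close> and \<open>g v\<close> is a periodic function of \<open>v\<close>, and it is bounded because periods move every
  point into the compact set \<open>K\<close>. By Liouville's theorem on complex lines \<open>g (v + h) - g v\<close> does not depend on \<open>v\<close>, so
  the derivative of \<open>g\<close> is constant.
\<close>

theorem periodic_lift_affine:
  assumes qg: "\<And>v. q (g v) = f v"
    and hol: "\<And>v. hol_C2_at (fst \<circ> g) v" "\<And>v. hol_C2_at (snd \<circ> g) v"
    and periodic: "\<And>v l. l \<in> \<Lambda> \<Longrightarrow> f (v + l) = f v"
    and cocompact: "compact K" "\<And>v. \<exists>l\<in>\<Lambda>. v + l \<in> K"
  shows "\<exists>a b c d c1 c2. \<forall>z w. g (z, w) = (a * z + b * w + c1, c * z + d * w + c2)"
proof -
  have "continuous_on UNIV (\<lambda>v. ((fst \<circ> g) v, (snd \<circ> g) v))"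
    by (intro continuous_on_Pair continuous_at_imp_continuous_on ballI hol_C2_at_continuous hol)
  then have cg: "continuous_on UNIV g" by simp
  have osc: "dist (g (v + l + h)) (g (v + l)) = dist (g (v + h)) (g v)" if l: "l \<in> \<Lambda>" for v h l
  proof -
    have cgl: "continuous_on UNIV (\<lambda>v. g (v + l))"
      by (rule continuous_on_compose2[OF cg]) (auto intro!: continuous_intros)
    have "q (g v) = q (g (v + l))" for v using qg periodic[OF l] by simp
    then obtain \<gamma> where \<gamma>: "\<gamma> \<in> \<Gamma>" "\<And>v. g (v + l) = \<gamma> (g v)"
      using lift_unique[OF cg cgl] by blast
    have "v + l + h = v + h + l" by (simp add: algebra_simps)
    then show ?thesis using isometry[OF \<gamma>(1)] by (simp only: \<gamma>(2))
  qed
  have bdd: "\<exists>M. \<forall>v. dist (g (v + h)) (g v) \<le> M" for h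
  proof -
    have "continuous_on K (\<lambda>v. dist (g (v + h)) (g v))"
      by (intro continuous_on_dist continuous_on_compose2[OF cg]) (auto intro!: continuous_intros)
    then have "compact ((\<lambda>v. dist (g (v + h)) (g v)) ` K)"
      using cocompact(1) compact_continuous_image by blast
    then obtain M where M: "\<forall>y\<in>(\<lambda>v. dist (g (v + h)) (g v)) ` K. norm y \<le> M"
      using compact_imp_bounded bounded_iff by metis
    have M: "dist (g (v + h)) (g v) \<le> M" if "v \<in> K" for v
      using bspec[OF M imageI[OF that]] by simp
    have "dist (g (v + h)) (g v) \<le> M" for v
    proof -
      obtain l where "l \<in> \<Lambda>" "v + l \<in> K" using cocompact(2) by blast
      then show ?thesis using M[of "v + l"] osc[of l v h] by simp
    qed
    then show ?thesis by blast
  qed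
  have const: "p (g (v + h)) - p (g v) = p (g h) - p (g 0)"
    if p: "\<And>v. hol_C2_at (p \<circ> g) v" "\<And>x y. cmod (p x - p y) \<le> dist x y" for p :: "complex \<times> complex \<Rightarrow> complex" and v h
  proof -
    obtain v1 v2 h1 h2 where v: "v = (v1, v2)" and h: "h = (h1, h2)" by fastforce
    \<comment> \<open>The increment of \<open>p \<circ> g\<close> by \<open>h\<close> along the complex line through \<open>0\<close> and \<open>v\<close>.\<close>
    define k where "k = (\<lambda>t. (p \<circ> g) (h1 + t * v1, h2 + t * v2) - (p \<circ> g) (0 + t * v1, 0 + t * v2))"
    have "k field_differentiable at t" for t
      unfolding k_def by (intro field_differentiable_diff hol_C2_at_on_line p)
    then have "k holomorphic_on UNIV" by (simp add: holomorphic_on_def)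
    moreover obtain M where M: "\<And>v. dist (g (v + h)) (g v) \<le> M" using bdd by blast
    have "cmod (k t) \<le> M" for t
      using p(2)[of "g (h1 + t * v1, h2 + t * v2)" "g (t * v1, t * v2)"] M[of "(t * v1, t * v2)"]
      by (simp add: k_def h add.commute)
    then have "bounded (range k)" by (auto simp: bounded_iff)
    ultimately have "k constant_on UNIV" by (rule Liouville_theorem)
    then have "k 1 = k 0" by (auto simp: constant_on_def)
    then show ?thesis by (simp add: k_def v h add.commute zero_prod_def)
  qed
  have affine: "\<exists>a b c. \<forall>z w. p (g (z, w)) = a * z + b * w + c"
    if p: "\<And>v. hol_C2_at (p \<circ> g) v" "\<And>x y. cmod (p x - p y) \<le> dist x y" for p :: "complex \<times> complex \<Rightarrow> complex"
  proof -
    obtain a b where ab: "((p \<circ> g) has_derivative (\<lambda>(v, w). a * v + b * w)) (at 0)"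
      using p(1)[of 0] unfolding hol_C2_at_def by blast
    \<comment> \<open>As increments do not depend on the base point, the derivative at the origin is the derivative everywhere.\<close>
    have der: "((p \<circ> g) has_derivative (\<lambda>(v, w). a * v + b * w)) (at x)" for x
    proof -
      have "((\<lambda>y. y - x) has_derivative (\<lambda>h. h)) (at x)" by (auto intro!: derivative_eq_intros)
      moreover have "((p \<circ> g) has_derivative (\<lambda>(v, w). a * v + b * w)) (at (x - x))" using ab by simp
      ultimately have "((\<lambda>y. (p \<circ> g) (y - x)) has_derivative (\<lambda>(v, w). a * v + b * w)) (at x)"
        by (rule has_derivative_compose)
      then have "((\<lambda>y. (p \<circ> g) (y - x) + (p (g x) - p (g 0))) has_derivative (\<lambda>(v, w). a * v + b * w)) (at x)"
        by (auto intro!: derivative_eq_intros)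
      moreover have "(p \<circ> g) (y - x) + (p (g x) - p (g 0)) = (p \<circ> g) y" for y
        using const[OF p, of "y - x" x] by (simp add: algebra_simps)
      ultimately show ?thesis by (simp add: o_def)
    qed
    have "((\<lambda>y. (p \<circ> g) y - (a * fst y + b * snd y)) has_derivative (\<lambda>h. 0)) (at x within UNIV)" for x
      by (rule has_derivative_eq_rhs,
          rule has_derivative_diff[OF der has_derivative_add[OF
            has_derivative_mult_right[OF has_derivative_fst[OF has_derivative_ident]]
            has_derivative_mult_right[OF has_derivative_snd[OF has_derivative_ident]]]])
         (auto simp: fun_eq_iff)
    then have "\<exists>c. \<forall>y\<in>UNIV. (p \<circ> g) y - (a * fst y + b * snd y) = c"
      by (rule has_derivative_zero_constant[OF convex_UNIV])
    then obtain c where c: "\<And>y. p (g y) - (a * fst y + b * snd y) = c" by auto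
    have "p (g (z, w)) = a * z + b * w + c" for z w
      using c[of "(z, w)"] by (simp add: algebra_simps)
    then show ?thesis by blast
  qed
  have "cmod (fst x - fst y) \<le> dist x y" "cmod (snd x - snd y) \<le> dist x y" for x y :: "complex \<times> complex"
    using dist_fst_le[of x y] dist_snd_le[of x y] by (simp_all add: dist_norm)
  then obtain a b c1 c d c2 where "\<And>z w. fst (g (z, w)) = a * z + b * w + c1"
    "\<And>z w. snd (g (z, w)) = c * z + d * w + c2"
    using affine[OF hol(1)] affine[OF hol(2)] by blast
  then have "g (z, w) = (a * z + b * w + c1, c * z + d * w + c2)" for z w by (simp add: prod_eq_iff)
  then show ?thesis by (intro exI allI)
qed

end

section \<open>Lattices and complex tori\<close>

definition additive_subgroup :: "complex set \<Rightarrow> bool" where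
  "additive_subgroup L \<longleftrightarrow> 0 \<in> L \<and> (\<forall>x\<in>L. \<forall>y\<in>L. x + y \<in> L) \<and> (\<forall>x\<in>L. - x \<in> L)"

lemma lattice_additive:
  assumes "is_lattice L" shows "additive_subgroup L"
proof -
  obtain a b where L: "L = lattice a b" using assms by (auto simp: is_lattice_def)
  have "0 \<in> L" unfolding L lattice_def by (rule CollectI, rule exI[of _ 0], rule exI[of _ 0]) simp
  moreover have "x + y \<in> L" if xy: "x \<in> L" "y \<in> L" for x y
  proof -
    from xy obtain m n m' n' where "x = of_int m * a + of_int n * b" "y = of_int m' * a + of_int n' * b"
      unfolding L lattice_def by blast
    then have "x + y = of_int (m + m') * a + of_int (n + n') * b" by (simp add: algebra_simps)
    then show ?thesis unfolding L lattice_def by blast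
  qed
  moreover have "- x \<in> L" if x: "x \<in> L" for x
  proof -
    from x obtain m n where "x = of_int m * a + of_int n * b" unfolding L lattice_def by blast
    then have "- x = of_int (- m) * a + of_int (- n) * b" by (simp add: algebra_simps)
    then show ?thesis unfolding L lattice_def by blast
  qed
  ultimately show ?thesis unfolding additive_subgroup_def by blast
qed

lemma lattice_form:
  assumes "is_lattice L"
  obtains a u where "a \<noteq> 0" "Im u \<noteq> 0"
    "L = {a * (of_int m + of_int n * u) | m n. True}"
proof -
  obtain a b where ab: "a \<noteq> 0" "Im (b / a) \<noteq> 0" "L = lattice a b"
    using assms by (auto simp: is_lattice_def)
  moreover have "a * (of_int m + of_int n * (b / a)) = of_int m * a + of_int n * b" for m n
    using ab(1) by (simp add: field_simps)
  ultimately show ?thesis using that[of a "b / a"] by (simp add: lattice_def)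
qed

text \<open>
  For \<open>x = a (m + n u)\<close> the imaginary part of \<open>x / a\<close> is at least \<open>\<bar>Im u\<bar>\<close> in modulus unless \<open>n = 0\<close>.
\<close>

lemma lattice_discrete:
  assumes "is_lattice L"
  obtains \<delta> where "\<delta> > 0" "\<And>x. x \<in> L \<Longrightarrow> x \<noteq> 0 \<Longrightarrow> \<delta> \<le> cmod x"
proof -
  obtain a u where a: "a \<noteq> 0" and im: "Im u \<noteq> 0"
    and L: "L = {a * (of_int m + of_int n * u) | m n. True}"
    using lattice_form[OF assms] .
  have "cmod a * min 1 \<bar>Im u\<bar> \<le> cmod x" if "x \<in> L" "x \<noteq> 0" for x
  proof -
    from that obtain m n where x: "x = a * (of_int m + of_int n * u)" unfolding L by blast
    have "min 1 \<bar>Im u\<bar> \<le> cmod (of_int m + of_int n * u)"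
    proof (cases "n = 0")
      case True
      then have "m \<noteq> 0" using that(2) x by auto
      then have "1 \<le> \<bar>real_of_int m\<bar>" by linarith
      then show ?thesis using True by simp
    next
      case False
      then have "1 \<le> \<bar>real_of_int n\<bar>" by linarith
      then have "\<bar>Im u\<bar> \<le> \<bar>real_of_int n\<bar> * \<bar>Im u\<bar>"
        using mult_right_mono[of 1 "\<bar>real_of_int n\<bar>" "\<bar>Im u\<bar>"] by simp
      also have "\<dots> = \<bar>Im (of_int m + of_int n * u)\<bar>" by (simp add: abs_mult)
      also have "\<dots> \<le> cmod (of_int m + of_int n * u)" by (rule abs_Im_le_cmod)
      finally show ?thesis by linarith
    qed
    then show ?thesis unfolding x norm_mult by (intro mult_left_mono) auto
  qed
  moreover have "cmod a * min 1 \<bar>Im u\<bar> > 0" using a im by simp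
  ultimately show ?thesis by (intro that)
qed

lemma lattice_cocompact:
  assumes "is_lattice L"
  shows "\<exists>R. \<forall>z. \<exists>l\<in>L. z + l \<in> cball 0 R"
proof -
  obtain a u where a: "a \<noteq> 0" and im: "Im u \<noteq> 0"
    and L: "L = {a * (of_int m + of_int n * u) | m n. True}"
    using lattice_form[OF assms] .
  have "\<exists>l\<in>L. z + l \<in> cball 0 (cmod a * (1 + cmod u))" for z
  proof -
    define y where "y = z / a"
    \<comment> \<open>The real coordinates of \<open>z\<close> with respect to the basis of the lattice are \<open>r\<close> and \<open>s\<close>.\<close>
    define s where "s = Im y / Im u"
    define r where "r = Re y - s * Re u"
    have y: "y = of_real r + of_real s * u"
      using im by (simp add: complex_eq_iff r_def s_def)
    let ?l = "a * (of_int (- \<lfloor>r\<rfloor>) + of_int (- \<lfloor>s\<rfloor>) * u)"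
    have lL: "?l \<in> L" unfolding L by blast
    have "z = a * y" using a by (simp add: y_def)
    then have zl: "z + ?l = a * (of_real (frac r) + of_real (frac s) * u)"
      by (simp add: y frac_def algebra_simps)
    have "cmod (of_real (frac r) + of_real (frac s) * u) \<le> frac r + frac s * cmod u"
      using norm_triangle_ineq[of "of_real (frac r)" "of_real (frac s) * u"]
      by (simp add: norm_mult)
    also have "\<dots> \<le> 1 + cmod u"
      using frac_lt_1[of r] frac_lt_1[of s] frac_ge_0[of s]
      by (intro add_mono) (simp_all add: mult_left_le_one_le)
    finally have "z + ?l \<in> cball 0 (cmod a * (1 + cmod u))"
      unfolding zl by (simp add: norm_mult mult_left_mono)
    then show ?thesis using lL by blast
  qed
  then show ?thesis by blast
qed

lemma lattice_not_UNIV: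
  assumes "is_lattice L" obtains x where "x \<notin> L"
proof -
  obtain \<delta> where d: "\<delta> > 0" "\<And>x. x \<in> L \<Longrightarrow> x \<noteq> 0 \<Longrightarrow> \<delta> \<le> cmod x"
    using lattice_discrete[OF assms] by blast
  have "of_real (\<delta> / 2) \<notin> L"
  proof
    assume "of_real (\<delta> / 2) \<in> L"
    from d(2)[OF this] d(1) show False by simp
  qed
  then show ?thesis by (rule that)
qed

lemma tpt_eq: "tpt L z = {l + z | l. l \<in> L}"
  by (auto simp: tpt_def r_coset_def complex_add_group_def)

lemma tpt_eq_iff:
  assumes "additive_subgroup L" shows "tpt L z = tpt L w \<longleftrightarrow> w - z \<in> L"
proof
  assume "tpt L z = tpt L w"
  moreover have "w \<in> tpt L w" using assms by (auto simp: tpt_eq additive_subgroup_def intro!: exI[of _ 0])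
  ultimately have "w \<in> tpt L z" by simp
  then show "w - z \<in> L" by (auto simp: tpt_eq)
next
  have sub: "tpt L w \<subseteq> tpt L z" if "w - z \<in> L" for z w
  proof
    fix x assume "x \<in> tpt L w"
    then obtain l where "l \<in> L" "x = l + w" by (auto simp: tpt_eq)
    then have "l + (w - z) \<in> L" "x = l + (w - z) + z" using assms that by (auto simp: additive_subgroup_def)
    then show "x \<in> tpt L z" unfolding tpt_eq by blast
  qed
  assume h: "w - z \<in> L"
  then have "- (w - z) \<in> L" using assms unfolding additive_subgroup_def by blast
  then show "tpt L z = tpt L w" using sub[OF h] sub[of z w] by simp
qed

lemma carrier_torus: "carrier (torus L) = range (tpt L)"
  by (simp add: torus_def carrier_FactGroup tpt_def complex_add_group_def)

lemma tpt_in_torus: "tpt L z \<in> carrier (torus L)"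
  by (simp add: carrier_torus)

lemma tpt_mult:
  assumes "additive_subgroup L" shows "tpt L z \<otimes>\<^bsub>torus L\<^esub> tpt L w = tpt L (z + w)"
proof -
  have "tpt L z \<otimes>\<^bsub>torus L\<^esub> tpt L w = {h + k | h k. h \<in> tpt L z \<and> k \<in> tpt L w}"
    by (auto simp: torus_def set_mult_def complex_add_group_def)
  also have "\<dots> = tpt L (z + w)"
  proof (intro equalityI subsetI)
    fix x assume "x \<in> {h + k | h k. h \<in> tpt L z \<and> k \<in> tpt L w}"
    then obtain l m where lm: "l \<in> L" "m \<in> L" "x = (l + z) + (m + w)" by (auto simp: tpt_eq)
    then have "l + m \<in> L" "x = (l + m) + (z + w)" using assms by (auto simp: additive_subgroup_def)
    then show "x \<in> tpt L (z + w)" unfolding tpt_eq by blast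
  next
    fix x assume "x \<in> tpt L (z + w)"
    then obtain l where "l \<in> L" "x = (l + z) + (0 + w)" by (auto simp: tpt_eq algebra_simps)
    moreover have "0 \<in> L" using assms by (simp add: additive_subgroup_def)
    ultimately show "x \<in> {h + k | h k. h \<in> tpt L z \<and> k \<in> tpt L w}" unfolding tpt_eq by blast
  qed
  finally show ?thesis .
qed

lemma one_torus: "\<one>\<^bsub>torus L\<^esub> = tpt L 0"
  by (simp add: torus_def tpt_eq)

lemma torus_group:
  assumes "additive_subgroup L" shows "group (torus L)"
proof (rule groupI)
  fix x assume "x \<in> carrier (torus L)"
  then obtain z where z: "x = tpt L z" by (auto simp: carrier_torus)
  show "\<exists>y\<in>carrier (torus L). y \<otimes>\<^bsub>torus L\<^esub> x = \<one>\<^bsub>torus L\<^esub>"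
    by (rule bexI[of _ "tpt L (- z)"]) (simp_all add: z tpt_mult[OF assms] one_torus carrier_torus)
qed (auto simp: carrier_torus tpt_mult[OF assms] one_torus add.assoc)

lemma tpt_inv:
  assumes "additive_subgroup L" shows "inv\<^bsub>torus L\<^esub> (tpt L z) = tpt L (- z)"
  by (rule group.inv_equality[OF torus_group[OF assms]])
     (simp_all add: tpt_mult[OF assms] one_torus carrier_torus)

lemma tpt_pow:
  assumes "additive_subgroup L" shows "tpt L z [^]\<^bsub>torus L\<^esub> (n :: nat) = tpt L (of_nat n * z)"
proof (induction n)
  case (Suc n)
  then show ?case
    by (simp add: tpt_mult[OF assms] algebra_simps)
qed (simp add: one_torus)

section \<open>The action on the fibre\<close>

text \<open>
  The automorphisms of \<open>F\<close> that lift to affine isometries of the plane.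
\<close>

definition affine_unitary :: "complex set \<Rightarrow> (complex set \<Rightarrow> complex set \<Rightarrow> complex set) \<Rightarrow> complex set \<Rightarrow> bool" where
  "affine_unitary M \<alpha> g \<longleftrightarrow> (\<exists>\<zeta> t. cmod \<zeta> = 1 \<and> acts_by M \<alpha> g (\<lambda>w. \<zeta> * w + t))"

lemma affine_unitary_mult:
  assumes act: "group_action H (carrier (torus M)) \<alpha>"
    and g: "g \<in> carrier H" "affine_unitary M \<alpha> g" and h: "h \<in> carrier H" "affine_unitary M \<alpha> h"
  shows "affine_unitary M \<alpha> (g \<otimes>\<^bsub>H\<^esub> h)"
proof -
  from g h obtain \<zeta> t \<zeta>' t' where z: "cmod \<zeta> = 1" "cmod \<zeta>' = 1"
    and a: "acts_by M \<alpha> g (\<lambda>w. \<zeta> * w + t)" "acts_by M \<alpha> h (\<lambda>w. \<zeta>' * w + t')"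
    unfolding affine_unitary_def by blast
  have "acts_by M \<alpha> (g \<otimes>\<^bsub>H\<^esub> h) (\<lambda>w. (\<zeta> * \<zeta>') * w + (\<zeta> * t' + t))"
    using a group_action.composition_rule[OF act tpt_in_torus g(1) h(1)]
    by (simp add: acts_by_def algebra_simps)
  moreover have "cmod (\<zeta> * \<zeta>') = 1" using z by (simp add: norm_mult)
  ultimately show ?thesis unfolding affine_unitary_def by blast
qed

lemma affine_unitary_one:
  assumes act: "group_action H (carrier (torus M)) \<alpha>"
  shows "affine_unitary M \<alpha> \<one>\<^bsub>H\<^esub>"
proof -
  have "\<alpha> \<one>\<^bsub>H\<^esub> (tpt M z) = tpt M (1 * z + 0)" for z
    using group_action.id_eq_one[OF act] tpt_in_torus[of M z] by (metis add_0_right mult_1 restrict_apply')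
  then show ?thesis unfolding affine_unitary_def acts_by_def
    by (intro exI[of _ 1] exI[of _ 0]) simp
qed

text \<open>
  These automorphisms are closed under composition, so that it suffices to look at a generator.
\<close>

lemma affine_unitary_cyclic:
  assumes act: "group_action H (carrier (torus M)) \<alpha>"
    and \<kappa>: "\<kappa> \<in> hom (integer_mod_group m) H" and m: "m > 1"
    and gen: "affine_unitary M \<alpha> (\<kappa> 1)" and k: "k \<in> carrier (integer_mod_group m)"
  shows "affine_unitary M \<alpha> (\<kappa> k)"
proof -
  have H: "group H" using act by (simp add: group_action_def group_hom_def)
  have one: "1 \<in> carrier (integer_mod_group m)" using m by simp
  have "affine_unitary M \<alpha> (\<kappa> (int j mod int m))" for j :: nat
  proof (induction j)
    case 0
    have "\<kappa> 0 = \<one>\<^bsub>H\<^esub>" using hom_one[OF \<kappa> group_integer_mod_group H] by simp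
    then show ?case using affine_unitary_one[OF act] by simp
  next
    case (Suc j)
    have j: "int j mod int m \<in> carrier (integer_mod_group m)" using m by (simp add: carrier_integer_mod_group)
    have "\<kappa> (int (Suc j) mod int m) = \<kappa> (int j mod int m \<otimes>\<^bsub>integer_mod_group m\<^esub> 1)"
      by (simp add: mod_simps add.commute)
    also have "\<dots> = \<kappa> (int j mod int m) \<otimes>\<^bsub>H\<^esub> \<kappa> 1" by (rule hom_mult[OF \<kappa> j one])
    finally show ?case
      using affine_unitary_mult[OF act hom_in_carrier[OF \<kappa> j] Suc.IH hom_in_carrier[OF \<kappa> one] gen] by simp
  qed
  from this[of "nat k"] show ?thesis using k m by (simp add: carrier_integer_mod_group)
qed

lemma cyclic_type_facts:
  assumes act: "group_action (translation_group L G) (carrier (torus M)) \<alpha>"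
    and type: "cyclic_type m (\<lambda>z. \<zeta> * z) L M G \<alpha>" and m: "m > 1" and \<zeta>: "cmod \<zeta> = 1"
  shows "\<forall>g\<in>G. affine_unitary M \<alpha> g" and "\<exists>g\<in>G. acts_by M \<alpha> g (\<lambda>w. \<zeta> * w + 0)"
proof -
  obtain \<psi> where iso: "\<psi> \<in> iso (integer_mod_group m) (translation_group L G)"
    and \<psi>1: "acts_by M \<alpha> (\<psi> 1) (\<lambda>z. \<zeta> * z + 0)"
    using type unfolding cyclic_type_def by auto
  have hom: "\<psi> \<in> hom (integer_mod_group m) (translation_group L G)"
    and G: "\<psi> ` carrier (integer_mod_group m) = G"
    using iso by (auto simp: iso_def bij_betw_def)
  have "affine_unitary M \<alpha> (\<psi> 1)" unfolding affine_unitary_def using \<psi>1 \<zeta> by blast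
  from affine_unitary_cyclic[OF act hom m this]
  show "\<forall>g\<in>G. affine_unitary M \<alpha> g" using G by blast
  have "1 \<in> carrier (integer_mod_group m)" using m by simp
  then show "\<exists>g\<in>G. acts_by M \<alpha> g (\<lambda>w. \<zeta> * w + 0)" using G \<psi>1 by blast
qed

lemma bicyclic_type_facts:
  assumes act: "group_action (translation_group L G) (carrier (torus M)) \<alpha>"
    and type: "bicyclic_type m n (\<lambda>z. \<zeta> * z) (\<lambda>z. z + \<epsilon>) L M G \<alpha>"
    and m: "m > 1" and n: "n > 1" and \<zeta>: "cmod \<zeta> = 1"
  shows "\<forall>g\<in>G. affine_unitary M \<alpha> g" and "\<exists>g\<in>G. acts_by M \<alpha> g (\<lambda>w. \<zeta> * w + 0)"
    and "\<exists>g\<in>G. acts_by M \<alpha> g (\<lambda>w. w + \<epsilon>)"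
proof -
  let ?A = "integer_mod_group m" and ?B = "integer_mod_group n" and ?H = "translation_group L G"
  obtain \<psi> where iso: "\<psi> \<in> iso (?A \<times>\<times> ?B) ?H"
    and \<psi>1: "acts_by M \<alpha> (\<psi> (1, 0)) (\<lambda>z. \<zeta> * z + 0)" and \<psi>2: "acts_by M \<alpha> (\<psi> (0, 1)) (\<lambda>z. z + \<epsilon>)"
    using type unfolding bicyclic_type_def by auto
  have hom: "\<psi> \<in> hom (?A \<times>\<times> ?B) ?H" and G: "\<psi> ` carrier (?A \<times>\<times> ?B) = G"
    using iso by (auto simp: iso_def bij_betw_def)
  have "(\<lambda>k. (k, 0)) \<in> hom ?A (?A \<times>\<times> ?B)" "(\<lambda>k. (0, k)) \<in> hom ?B (?A \<times>\<times> ?B)"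
    by (auto simp: hom_def)
  then have hom1: "\<psi> \<circ> (\<lambda>k. (k, 0)) \<in> hom ?A ?H" and hom2: "\<psi> \<circ> (\<lambda>k. (0, k)) \<in> hom ?B ?H"
    using hom by (auto intro: hom_compose)
  have "affine_unitary M \<alpha> ((\<psi> \<circ> (\<lambda>k. (k, 0))) 1)"
    unfolding affine_unitary_def comp_def using \<psi>1 \<zeta> by blast
  note A = affine_unitary_cyclic[OF act hom1 m this]
  have "acts_by M \<alpha> (\<psi> (0, 1)) (\<lambda>z. 1 * z + \<epsilon>)" using \<psi>2 by simp
  then have "affine_unitary M \<alpha> ((\<psi> \<circ> (\<lambda>k. (0, k))) 1)"
    unfolding affine_unitary_def comp_def by (intro exI[of _ 1] exI[of _ \<epsilon>]) simp
  note B = affine_unitary_cyclic[OF act hom2 n this]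
  have one: "(1, 0) \<in> carrier (?A \<times>\<times> ?B)" "(0, 1) \<in> carrier (?A \<times>\<times> ?B)" using m n by simp_all
  show "\<forall>g\<in>G. affine_unitary M \<alpha> g"
  proof
    fix g assume "g \<in> G"
    then obtain i j where ij: "i \<in> carrier ?A" "j \<in> carrier ?B" "g = \<psi> (i, j)" using G by auto
    have c: "(i, 0) \<in> carrier (?A \<times>\<times> ?B)" "(0, j) \<in> carrier (?A \<times>\<times> ?B)" using ij by simp_all
    have "(i, 0) \<otimes>\<^bsub>?A \<times>\<times> ?B\<^esub> (0, j) = (i, j)"
      using ij m n by (simp add: carrier_integer_mod_group)
    then have "g = \<psi> (i, 0) \<otimes>\<^bsub>?H\<^esub> \<psi> (0, j)" using hom_mult[OF hom c] ij(3) by simp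
    then show "affine_unitary M \<alpha> g"
      using affine_unitary_mult[OF act hom_in_carrier[OF hom c(1)] _ hom_in_carrier[OF hom c(2)]]
        A[OF ij(1)] B[OF ij(2)] by simp
  qed
  show "\<exists>g\<in>G. acts_by M \<alpha> g (\<lambda>w. \<zeta> * w + 0)" using G \<psi>1 one by blast
  show "\<exists>g\<in>G. acts_by M \<alpha> g (\<lambda>w. w + \<epsilon>)" using G \<psi>2 one by blast
qed

lemma cube_root_of_unity_facts:
  fixes \<rho> :: complex
  assumes "\<rho> ^ 3 = 1" "\<rho> \<noteq> 1"
  shows "cmod \<rho> = 1" "- \<rho> \<noteq> 1" "Im \<rho> \<noteq> 0"
proof -
  have "cmod \<rho> ^ 3 = 1" using assms(1) by (metis norm_one norm_power)
  then show "cmod \<rho> = 1" using power_eq_imp_eq_base[of "cmod \<rho>" 3 1] by simp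
  show "- \<rho> \<noteq> 1"
  proof
    assume "- \<rho> = 1"
    then have "\<rho> = - 1" by (metis minus_minus)
    then show False using assms(1) by simp
  qed
  have "(\<rho> - 1) * (\<rho>\<^sup>2 + \<rho> + 1) = 0" using assms(1) by (simp add: algebra_simps power2_eq_square power3_eq_cube)
  then have "\<rho>\<^sup>2 + \<rho> + 1 = 0" using assms(2) by simp
  then have re: "Re (\<rho>\<^sup>2 + \<rho> + 1) = 0" by simp
  show "Im \<rho> \<noteq> 0"
  proof
    assume "Im \<rho> = 0"
    with re have "(Re \<rho>)\<^sup>2 + Re \<rho> + 1 = 0" by (simp add: power2_eq_square)
    moreover have "(Re \<rho>)\<^sup>2 + Re \<rho> + 1 = (Re \<rho> + 1 / 2)\<^sup>2 + 3 / 4" by (simp add: power2_eq_square algebra_simps)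
    moreover have "(Re \<rho> + 1 / 2)\<^sup>2 \<ge> 0" by simp
    ultimately show False by linarith
  qed
qed

text \<open>
  All that the proof takes from the list of types: \<open>G\<close> acts on \<open>F\<close> by affine isometries, some element
  of \<open>G\<close> acts by a proper rotation about the origin, and in the types 2, 4 and 6 some element acts by
  a nonzero translation.
\<close>

lemma bielliptic_type_facts:
  assumes \<rho>: "\<rho> ^ 3 = 1" "\<rho> \<noteq> 1"
    and act: "group_action (translation_group L G) (carrier (torus M)) \<alpha>"
    and type: "has_bielliptic_type \<rho> \<tau> L M G \<alpha>"
  shows "\<forall>g\<in>G. affine_unitary M \<alpha> g"
    and "\<exists>g\<in>G. \<exists>\<zeta>. \<zeta> \<noteq> 1 \<and> cmod \<zeta> = 1 \<and> acts_by M \<alpha> g (\<lambda>w. \<zeta> * w + 0)"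
    and "\<tau> \<in> {Type1, Type3, Type5, Type7} \<or> (\<exists>g\<in>G. \<exists>\<epsilon>. \<epsilon> \<notin> M \<and> acts_by M \<alpha> g (\<lambda>w. w + \<epsilon>))"
proof -
  note r = cube_root_of_unity_facts[OF \<rho>]
  have neg: "(\<lambda>z :: complex. - z) = (\<lambda>z. (- 1) * z)" by simp
  have i: "(1 + \<i>) / 2 \<notin> lattice 1 \<i>"
  proof
    assume "(1 + \<i>) / 2 \<in> lattice 1 \<i>"
    then obtain m n where "(1 + \<i>) / 2 = of_int m * 1 + of_int n * \<i>" unfolding lattice_def by blast
    then have "Re ((1 + \<i>) / 2) = Re (of_int m * 1 + of_int n * \<i>)" by simp
    then have "1 = 2 * real_of_int m" by simp
    then have "1 = 2 * m" by (metis of_int_1 of_int_eq_iff of_int_mult of_int_numeral)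
    then show False by presburger
  qed
  have r6: "(1 - \<rho>) / 3 \<notin> lattice 1 \<rho>"
  proof
    assume "(1 - \<rho>) / 3 \<in> lattice 1 \<rho>"
    then obtain m n where "(1 - \<rho>) / 3 = of_int m * 1 + of_int n * \<rho>" unfolding lattice_def by blast
    then have "Im ((1 - \<rho>) / 3) = Im (of_int m * 1 + of_int n * \<rho>)" by simp
    then have "- Im \<rho> = 3 * real_of_int n * Im \<rho>" by simp
    then have "(3 * real_of_int n + 1) * Im \<rho> = 0" by (simp add: algebra_simps)
    then have "3 * real_of_int n + 1 = 0" using r(3) by simp
    then have "3 * n + 1 = 0" by (metis (no_types) of_int_0 of_int_1 of_int_add of_int_eq_iff of_int_mult of_int_numeral)
    then show False by presburger
  qed
  have "(\<forall>g\<in>G. affine_unitary M \<alpha> g) \<and>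
    (\<exists>g\<in>G. \<exists>\<zeta>. \<zeta> \<noteq> 1 \<and> cmod \<zeta> = 1 \<and> acts_by M \<alpha> g (\<lambda>w. \<zeta> * w + 0)) \<and>
    (\<tau> \<in> {Type1, Type3, Type5, Type7} \<or> (\<exists>g\<in>G. \<exists>\<epsilon>. \<epsilon> \<notin> M \<and> acts_by M \<alpha> g (\<lambda>w. w + \<epsilon>)))"
    (is "?goal \<tau>")
  proof -
    have cyc: "?goal \<tau>" if "cyclic_type m (\<lambda>z. \<zeta> * z) L M G \<alpha>" "m > 1" "cmod \<zeta> = 1" "\<zeta> \<noteq> 1"
      "\<tau> \<in> {Type1, Type3, Type5, Type7}" for m \<zeta>
      using cyclic_type_facts[OF act that(1-3)] that(3-5) by blast
    have bic: "?goal \<tau>" if "bicyclic_type m n (\<lambda>z. \<zeta> * z) (\<lambda>z. z + \<epsilon>) L M G \<alpha>" "m > 1" "n > 1"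
      "cmod \<zeta> = 1" "\<zeta> \<noteq> 1" "\<epsilon> \<notin> M" for m n \<zeta> \<epsilon>
      using bicyclic_type_facts[OF act that(1-4)] that(4-6) by blast
    show ?thesis
    proof (cases \<tau>)
      case Type1
      show ?thesis by (rule cyc[of 2 "- 1"]) (use type Type1 in simp_all)
    next
      case Type2
      then obtain \<epsilon> where "\<epsilon> \<notin> M" "bicyclic_type 2 2 (\<lambda>z. - z) (\<lambda>z. z + \<epsilon>) L M G \<alpha>" using type by auto
      then show ?thesis by (intro bic[of 2 2 "- 1" \<epsilon>]) simp_all
    next
      case Type3
      have t: "cyclic_type 4 (\<lambda>z. \<i> * z) L M G \<alpha>"
        using type[unfolded Type3 has_bielliptic_type.simps] by (rule conjunct2)
      show ?thesis by (rule cyc[OF t]) (simp_all add: Type3 complex_eq_iff)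
    next
      case Type4
      have t: "bicyclic_type 4 2 (\<lambda>z. \<i> * z) (\<lambda>z. z + (1 + \<i>) / 2) L M G \<alpha>"
        and "M = lattice 1 \<i>"
        using type[unfolded Type4 has_bielliptic_type.simps] by blast+
      then have "(1 + \<i>) / 2 \<notin> M" using i by blast
      then show ?thesis by (intro bic[OF t]) (simp_all add: complex_eq_iff)
    next
      case Type5
      have t: "cyclic_type 3 (\<lambda>z. \<rho> * z) L M G \<alpha>"
        using type[unfolded Type5 has_bielliptic_type.simps] by (rule conjunct2)
      show ?thesis by (rule cyc[OF t]) (simp_all add: Type5 r \<rho>(2))
    next
      case Type6
      have t: "bicyclic_type 3 3 (\<lambda>z. \<rho> * z) (\<lambda>z. z + (1 - \<rho>) / 3) L M G \<alpha>"
        and "M = lattice 1 \<rho>"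
        using type[unfolded Type6 has_bielliptic_type.simps] by blast+
      then have "(1 - \<rho>) / 3 \<notin> M" using r6 by blast
      then show ?thesis by (intro bic[OF t]) (simp_all add: r \<rho>(2))
    next
      case Type7
      have t: "cyclic_type 6 (\<lambda>z. - \<rho> * z) L M G \<alpha>"
        using type[unfolded Type7 has_bielliptic_type.simps] by (rule conjunct2)
      show ?thesis by (rule cyc[OF t]) (simp_all add: Type7 r del: minus_equation_iff)
    qed
  qed
  then show "\<forall>g\<in>G. affine_unitary M \<alpha> g"
    and "\<exists>g\<in>G. \<exists>\<zeta>. \<zeta> \<noteq> 1 \<and> cmod \<zeta> = 1 \<and> acts_by M \<alpha> g (\<lambda>w. \<zeta> * w + 0)"
    and "\<tau> \<in> {Type1, Type3, Type5, Type7} \<or> (\<exists>g\<in>G. \<exists>\<epsilon>. \<epsilon> \<notin> M \<and> acts_by M \<alpha> g (\<lambda>w. w + \<epsilon>))"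
    by simp_all
qed

section \<open>The universal covering of a bielliptic surface\<close>

text \<open>
  The action on \<open>F\<close> enters in the affine form in which the types present it.
\<close>

locale bielliptic =
  fixes L M :: "complex set" and G :: "complex set set"
    and \<alpha> :: "complex set \<Rightarrow> complex set \<Rightarrow> complex set"
  assumes L: "is_lattice L" and M: "is_lattice M"
    and subgr: "subgroup G (torus L)" and fin: "finite G"
    and action: "group_action (translation_group L G) (carrier (torus M)) \<alpha>"
    and affine_action: "g \<in> G \<Longrightarrow> affine_unitary M \<alpha> g"
begin

lemmas addL = lattice_additive[OF L] and addM = lattice_additive[OF M]

abbreviation "L' \<equiv> {l. tpt L l \<in> G}"

lemma G_tpt: assumes "g \<in> G" obtains l where "g = tpt L l"
  using subgroup.subset[OF subgr] assms carrier_torus by blast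

lemma L'_additive: "additive_subgroup L'"
  using subgroup.one_closed[OF subgr] subgroup.m_closed[OF subgr] subgroup.m_inv_closed[OF subgr]
  unfolding additive_subgroup_def by (simp add: one_torus flip: tpt_mult[OF addL] tpt_inv[OF addL])

text \<open>
  The set \<open>L'\<close> is the preimage of \<open>G\<close> in the universal covering of \<open>E\<close>. Multiplication by the order
  of \<open>G\<close> maps it into the lattice \<open>L\<close>.
\<close>

lemma L'_discrete:
  obtains \<delta> where "\<delta> > 0" "\<And>x. x \<in> L' \<Longrightarrow> x \<noteq> 0 \<Longrightarrow> \<delta> \<le> cmod x"
proof -
  obtain d where d: "d > 0" "\<And>x. x \<in> L \<Longrightarrow> x \<noteq> 0 \<Longrightarrow> d \<le> cmod x" using lattice_discrete[OF L] by blast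
  interpret H: group "translation_group L G"
    by (rule subgroup.subgroup_is_group[OF subgr torus_group[OF addL]])
  have n: "card G > 0" using fin subgroup.one_closed[OF subgr] card_gt_0_iff by blast
  have "d / card G \<le> cmod x" if x: "x \<in> L'" "x \<noteq> 0" for x
  proof -
    have "tpt L x [^]\<^bsub>translation_group L G\<^esub> order (translation_group L G) = \<one>\<^bsub>translation_group L G\<^esub>"
      by (rule H.pow_order_eq_1) (use x in simp)
    then have "tpt L x [^]\<^bsub>torus L\<^esub> card G = \<one>\<^bsub>torus L\<^esub>"
      by (simp add: order_def nat_pow_def)
    then have "tpt L 0 = tpt L (of_nat (card G) * x)" by (simp add: tpt_pow[OF addL] one_torus)
    then have "of_nat (card G) * x \<in> L" by (simp add: tpt_eq_iff[OF addL])
    from d(2)[OF this] have "d \<le> card G * cmod x" using n x(2) by (simp add: norm_mult)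
    then show ?thesis using n by (simp add: field_simps)
  qed
  then show ?thesis using that[of "d / card G"] d(1) n by auto
qed

lemma \<alpha>_one: "\<alpha> (tpt L 0) (tpt M w) = tpt M w"
proof -
  have "(\<lambda>x\<in>carrier (torus M). x) = \<alpha> \<one>\<^bsub>translation_group L G\<^esub>"
    by (rule group_action.id_eq_one[OF action])
  then have "\<alpha> (tpt L 0) = (\<lambda>x\<in>carrier (torus M). x)" by (simp add: one_torus)
  then show ?thesis by (simp add: carrier_torus)
qed

lemma \<alpha>_mult:
  assumes "l \<in> L'" "m \<in> L'"
  shows "\<alpha> (tpt L (l + m)) (tpt M w) = \<alpha> (tpt L l) (\<alpha> (tpt L m) (tpt M w))"
proof -
  have "\<alpha> (tpt L l \<otimes>\<^bsub>translation_group L G\<^esub> tpt L m) (tpt M w) = \<alpha> (tpt L l) (\<alpha> (tpt L m) (tpt M w))"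
    by (rule group_action.composition_rule[OF action]) (use assms in \<open>simp_all add: carrier_torus\<close>)
  then show ?thesis by (simp add: tpt_mult[OF addL])
qed

text \<open>
  The affine map \<open>w \<mapsto> \<zeta> w + t\<close> lifts the action on \<open>F\<close> of the element of \<open>G\<close> represented by \<open>l\<close>.
\<close>

definition lifts :: "complex \<Rightarrow> complex \<Rightarrow> complex \<Rightarrow> bool" where
  "lifts l \<zeta> t \<longleftrightarrow> l \<in> L' \<and> cmod \<zeta> = 1 \<and> acts_by M \<alpha> (tpt L l) (\<lambda>w. \<zeta> * w + t)"

definition screw_motion :: "complex \<Rightarrow> complex \<Rightarrow> complex \<Rightarrow> complex \<times> complex \<Rightarrow> complex \<times> complex" where
  "screw_motion l \<zeta> t = (\<lambda>(z, w). (z + l, \<zeta> * w + t))"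

definition deck :: "(complex \<times> complex \<Rightarrow> complex \<times> complex) set" where
  "deck = {screw_motion l \<zeta> t | l \<zeta> t. lifts l \<zeta> t}"

text \<open>
  The universal covering of \<open>(E \<times> F)/G\<close> by the plane.
\<close>

definition cover_S :: "complex \<times> complex \<Rightarrow> (complex set \<times> complex set) set" where
  "cover_S = EF_class L G \<alpha> \<circ> (\<lambda>(z, w). (tpt L z, tpt M w))"

definition cover_E :: "complex \<Rightarrow> complex set set" where
  "cover_E = E_class L G \<circ> tpt L"

lemma EF_mod_G_eq: "EF_mod_G L M G \<alpha> = fs_quotient hol_C2 cover_S"
  by (simp add: EF_mod_G_def torus_product_def fs_quotient_fs_quotient cover_S_def)

lemma E_mod_G_eq: "E_mod_G L G = fs_quotient hol_C cover_E"
  by (simp add: E_mod_G_def torus_space_def fs_quotient_fs_quotient cover_E_def)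

lemma lifts_ex: assumes "l \<in> L'" obtains \<zeta> t where "lifts l \<zeta> t"
  using affine_action assms unfolding lifts_def affine_unitary_def by blast

lemma lifts_0: "lifts 0 1 0"
  unfolding lifts_def acts_by_def using L'_additive by (simp add: \<alpha>_one additive_subgroup_def)

lemma lifts_translation: "lifts l \<zeta> t \<Longrightarrow> m \<in> M \<Longrightarrow> lifts l \<zeta> (t + m)"
  unfolding lifts_def acts_by_def by (simp add: tpt_eq_iff[OF addM])

lemma lifts_comp:
  assumes "lifts l \<zeta> t" "lifts l' \<zeta>' t'" shows "lifts (l' + l) (\<zeta> * \<zeta>') (\<zeta> * t' + t)"
proof -
  have "l + l' \<in> L'" using assms L'_additive unfolding lifts_def additive_subgroup_def by blast
  moreover have "\<alpha> (tpt L (l + l')) (tpt M w) = tpt M (\<zeta> * \<zeta>' * w + (\<zeta> * t' + t))" for w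
    using assms by (simp add: \<alpha>_mult lifts_def acts_by_def algebra_simps)
  ultimately show ?thesis using assms by (simp add: lifts_def acts_by_def norm_mult add.commute)
qed

lemma lifts_inverse:
  assumes "lifts l \<zeta> t" shows "lifts (- l) (1 / \<zeta>) (- t / \<zeta>)"
proof -
  have z: "\<zeta> \<noteq> 0" "cmod \<zeta> = 1" using assms unfolding lifts_def by auto
  have l: "l \<in> L'" "- l \<in> L'" using assms L'_additive unfolding lifts_def additive_subgroup_def by blast+
  have "\<alpha> (tpt L (- l)) (tpt M w) = tpt M (1 / \<zeta> * w + - t / \<zeta>)" for w
  proof -
    let ?v = "1 / \<zeta> * w + - t / \<zeta>"
    have "tpt M w = \<alpha> (tpt L l) (tpt M ?v)"
      using assms z by (simp add: lifts_def acts_by_def field_simps)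
    then have "\<alpha> (tpt L (- l)) (tpt M w) = \<alpha> (tpt L (- l + l)) (tpt M ?v)"
      using \<alpha>_mult[OF l(2,1), of ?v] by simp
    then show ?thesis by (simp add: \<alpha>_one)
  qed
  then show ?thesis using z l by (simp add: lifts_def acts_by_def norm_divide)
qed

text \<open>
  The difference of two lifts is an affine map into the lattice \<open>M\<close>, so it is constant. Thus the
  translation part \<open>l\<close> of a deck transformation determines its rotation part.
\<close>

lemma lifts_unique_rotation:
  assumes "lifts l \<zeta> t" "lifts l \<zeta>' t'" shows "\<zeta> = \<zeta>'" and "t' - t \<in> M"
proof -
  have *: "(\<zeta>' * w + t') - (\<zeta> * w + t) \<in> M" for w
    using assms unfolding lifts_def acts_by_def by (metis tpt_eq_iff[OF addM])
  show "\<zeta> = \<zeta>'"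
  proof (rule ccontr)
    assume "\<zeta> \<noteq> \<zeta>'"
    obtain x where x: "x \<notin> M" using lattice_not_UNIV[OF M] .
    let ?w = "(x - (t' - t)) / (\<zeta>' - \<zeta>)"
    have "(\<zeta>' * ?w + t') - (\<zeta> * ?w + t) = (\<zeta>' - \<zeta>) * ?w + (t' - t)" by (simp only: algebra_simps)
    also have "\<dots> = x" using \<open>\<zeta> \<noteq> \<zeta>'\<close> by simp
    finally show False using *[of ?w] x by simp
  qed
  then show "t' - t \<in> M" using *[of 0] by simp
qed


lemma lifts_cong: "lifts l \<zeta> t \<Longrightarrow> tpt L l' = tpt L l \<Longrightarrow> lifts l' \<zeta> t"
  unfolding lifts_def by simp

lemma cover_S_eq: "cover_S (z, w) = {(tpt L (z + l), tpt M (\<zeta> * w + t)) | l \<zeta> t. lifts l \<zeta> t}"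
proof (intro equalityI subsetI)
  fix p assume "p \<in> cover_S (z, w)"
  then obtain g where g: "g \<in> G" "p = (tpt L z \<otimes>\<^bsub>torus L\<^esub> g, \<alpha> g (tpt M w))"
    unfolding cover_S_def EF_class_def orbit_def by auto
  obtain l where l: "g = tpt L l" using G_tpt[OF g(1)] .
  then have "l \<in> L'" using g(1) by simp
  then obtain \<zeta> t where lt: "lifts l \<zeta> t" by (rule lifts_ex)
  then have "p = (tpt L (z + l), tpt M (\<zeta> * w + t))"
    unfolding g(2) l tpt_mult[OF addL] lifts_def acts_by_def by simp
  then show "p \<in> {(tpt L (z + l), tpt M (\<zeta> * w + t)) | l \<zeta> t. lifts l \<zeta> t}" using lt by blast
next
  fix p assume "p \<in> {(tpt L (z + l), tpt M (\<zeta> * w + t)) | l \<zeta> t. lifts l \<zeta> t}"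
  then obtain l \<zeta> t where lt: "lifts l \<zeta> t" and p: "p = (tpt L (z + l), tpt M (\<zeta> * w + t))" by blast
  then have "p = (tpt L z \<otimes>\<^bsub>torus L\<^esub> tpt L l, \<alpha> (tpt L l) (tpt M w))" "tpt L l \<in> G"
    unfolding tpt_mult[OF addL] lifts_def acts_by_def by simp_all
  then show "p \<in> cover_S (z, w)" unfolding cover_S_def EF_class_def orbit_def by auto
qed

lemma cover_S_lifts_subset:
  assumes "lifts l \<zeta> t" shows "cover_S (z + l, \<zeta> * w + t) \<subseteq> cover_S (z, w)"
proof
  fix p assume "p \<in> cover_S (z + l, \<zeta> * w + t)"
  then obtain l' \<zeta>' t' where lt': "lifts l' \<zeta>' t'"
    and p: "p = (tpt L (z + l + l'), tpt M (\<zeta>' * (\<zeta> * w + t) + t'))"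
    unfolding cover_S_eq by blast
  from p have "p = (tpt L (z + (l + l')), tpt M ((\<zeta>' * \<zeta>) * w + (\<zeta>' * t + t')))"
    by (simp add: algebra_simps)
  then show "p \<in> cover_S (z, w)" unfolding cover_S_eq using lifts_comp[OF lt' assms] by blast
qed

lemma cover_S_eq_iff: "cover_S (z, w) = cover_S (z', w') \<longleftrightarrow> (\<exists>l \<zeta> t. lifts l \<zeta> t \<and> z' = z + l \<and> w' = \<zeta> * w + t)"
proof
  assume eq: "cover_S (z, w) = cover_S (z', w')"
  have "(tpt L (z' + 0), tpt M (1 * w' + 0)) \<in> cover_S (z', w')" unfolding cover_S_eq using lifts_0 by blast
  then have "(tpt L z', tpt M w') \<in> cover_S (z, w)" by (simp add: eq)
  then obtain l \<zeta> t where lt: "lifts l \<zeta> t" and "tpt L z' = tpt L (z + l)"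
    "tpt M w' = tpt M (\<zeta> * w + t)" unfolding cover_S_eq by blast
  then have "l - (z' - z) \<in> L" "(w' - \<zeta> * w) - t \<in> M"
    unfolding eq_commute[of "tpt M w'"] by (simp_all add: tpt_eq_iff[OF addL] tpt_eq_iff[OF addM] algebra_simps)
  then have "tpt L (z' - z) = tpt L l" "lifts l \<zeta> (t + ((w' - \<zeta> * w) - t))"
    using lifts_translation[OF lt] by (simp_all only: tpt_eq_iff[OF addL])
  then have "lifts (z' - z) \<zeta> (w' - \<zeta> * w)" using lifts_cong by (simp add: algebra_simps)
  then show "\<exists>l \<zeta> t. lifts l \<zeta> t \<and> z' = z + l \<and> w' = \<zeta> * w + t"
    by (intro exI[of _ "z' - z"] exI[of _ \<zeta>] exI[of _ "w' - \<zeta> * w"]) simp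
next
  assume "\<exists>l \<zeta> t. lifts l \<zeta> t \<and> z' = z + l \<and> w' = \<zeta> * w + t"
  then obtain l \<zeta> t where lt: "lifts l \<zeta> t" and zw: "z' = z + l" "w' = \<zeta> * w + t" by blast
  have "\<zeta> \<noteq> 0" using lt unfolding lifts_def by auto
  then have "z = z' + - l" "w = 1 / \<zeta> * w' + - t / \<zeta>" by (simp_all add: zw field_simps)
  then have "cover_S (z, w) \<subseteq> cover_S (z', w')" using cover_S_lifts_subset[OF lifts_inverse[OF lt], of z' w'] by simp
  moreover have "cover_S (z', w') \<subseteq> cover_S (z, w)" unfolding zw by (rule cover_S_lifts_subset[OF lt])
  ultimately show "cover_S (z, w) = cover_S (z', w')" by simp
qed

text \<open>
  A deck transformation with \<open>l \<noteq> 0\<close> moves the first coordinate by a vector of the discrete group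
  \<open>L'\<close>; one with \<open>l = 0\<close> is a translation by a vector of \<open>M\<close>.
\<close>

lemma deck_covering: obtains \<delta> where "screw_covering deck \<delta> cover_S"
proof -
  obtain d where d: "d > 0" "\<And>x. x \<in> L' \<Longrightarrow> x \<noteq> 0 \<Longrightarrow> d \<le> cmod x" using L'_discrete by blast
  obtain e where e: "e > 0" "\<And>x. x \<in> M \<Longrightarrow> x \<noteq> 0 \<Longrightarrow> e \<le> cmod x" using lattice_discrete[OF M] by blast
  have "screw_covering deck (min d e) cover_S"
  proof
    show "id \<in> deck" unfolding deck_def screw_motion_def
      using lifts_0 by (force simp: fun_eq_iff)
    show "min d e > 0" using d e by simp
  next
    fix \<gamma> \<gamma>' assume "\<gamma> \<in> deck" "\<gamma>' \<in> deck"
    then obtain l \<zeta> t l' \<zeta>' t' where lt: "lifts l \<zeta> t" "lifts l' \<zeta>' t'"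
      and g: "\<gamma> = screw_motion l \<zeta> t" "\<gamma>' = screw_motion l' \<zeta>' t'" unfolding deck_def by blast
    have "\<gamma> \<circ> \<gamma>' = screw_motion (l' + l) (\<zeta> * \<zeta>') (\<zeta> * t' + t)"
      by (simp add: g screw_motion_def fun_eq_iff algebra_simps)
    then show "\<gamma> \<circ> \<gamma>' \<in> deck" unfolding deck_def using lifts_comp[OF lt] by blast
  next
    fix \<gamma> assume "\<gamma> \<in> deck"
    then obtain l \<zeta> t where lt: "lifts l \<zeta> t" and g: "\<gamma> = screw_motion l \<zeta> t" unfolding deck_def by blast
    have "\<zeta> \<noteq> 0" using lt unfolding lifts_def by auto
    then have "screw_motion (- l) (1 / \<zeta>) (- t / \<zeta>) \<circ> \<gamma> = id"
      by (simp add: g screw_motion_def fun_eq_iff field_simps)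
    then show "\<exists>\<gamma>'\<in>deck. \<gamma>' \<circ> \<gamma> = id" unfolding deck_def using lifts_inverse[OF lt] by blast
    show "\<exists>l \<zeta> t. cmod \<zeta> = 1 \<and> \<gamma> = (\<lambda>(z, w). (z + l, \<zeta> * w + t))"
      using lt unfolding g screw_motion_def lifts_def by blast
  next
    fix \<gamma> and x :: "complex \<times> complex" assume "\<gamma> \<in> deck" and ne: "\<gamma> \<noteq> id"
    then obtain l \<zeta> t where lt: "lifts l \<zeta> t" and g: "\<gamma> = screw_motion l \<zeta> t" unfolding deck_def by blast
    show "min d e \<le> dist (\<gamma> x) x"
    proof (cases "l = 0")
      case False
      then have "d \<le> cmod l" using lt d(2) unfolding lifts_def by blast
      also have "cmod l = dist (fst (\<gamma> x)) (fst x)" by (simp add: g screw_motion_def dist_norm split: prod.split)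
      also have "\<dots> \<le> dist (\<gamma> x) x" by (rule dist_fst_le)
      finally show ?thesis by simp
    next
      case True
      with lt have lt0: "lifts 0 \<zeta> t" by simp
      have z: "\<zeta> = 1" and t: "t \<in> M" using lifts_unique_rotation[OF lifts_0 lt0] by auto
      have "t \<noteq> 0" using ne unfolding g True z screw_motion_def by (auto simp: fun_eq_iff)
      then have "e \<le> cmod t" using t e(2) by blast
      also have "cmod t = dist (snd (\<gamma> x)) (snd x)" by (simp add: g z screw_motion_def dist_norm split: prod.split)
      also have "\<dots> \<le> dist (\<gamma> x) x" by (rule dist_snd_le)
      finally show ?thesis by simp
    qed
  next
    fix x y :: "complex \<times> complex"
    obtain z w z' w' where xy: "x = (z, w)" "y = (z', w')" by fastforce
    have "(\<exists>\<gamma>\<in>deck. y = \<gamma> x) \<longleftrightarrow> (\<exists>l \<zeta> t. lifts l \<zeta> t \<and> y = screw_motion l \<zeta> t x)"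
      unfolding deck_def by blast
    then show "cover_S x = cover_S y \<longleftrightarrow> (\<exists>\<gamma>\<in>deck. y = \<gamma> x)"
      by (simp add: xy cover_S_eq_iff screw_motion_def)
  qed
  then show ?thesis by (rule that)
qed

lemma morphism_lift_affine:
  assumes f: "fs_morphism hol_C2 (EF_mod_G L M G \<alpha>) f"
    and per: "\<And>z w l m. l \<in> L \<Longrightarrow> m \<in> M \<Longrightarrow> f (z + l, w + m) = f (z, w)"
  shows "\<exists>a b c d c1 c2. \<forall>z w. f (z, w) = cover_S (a * z + b * w + c1, c * z + d * w + c2)"
proof -
  obtain \<delta> where "screw_covering deck \<delta> cover_S" by (rule deck_covering)
  then interpret screw_covering deck \<delta> cover_S .
  obtain g where g: "\<And>v. cover_S (g v) = f v" "\<And>v. hol_C2_at (fst \<circ> g) v" "\<And>v. hol_C2_at (snd \<circ> g) v"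
    using holomorphic_lift[OF f[unfolded EF_mod_G_eq]] by blast
  obtain R where R: "\<And>z. \<exists>l\<in>L. z + l \<in> cball 0 R" using lattice_cocompact[OF L] by blast
  obtain R' where R': "\<And>z. \<exists>l\<in>M. z + l \<in> cball 0 R'" using lattice_cocompact[OF M] by blast
  have K2: "\<exists>l\<in>L \<times> M. v + l \<in> cball 0 R \<times> cball 0 R'" for v
  proof -
    obtain z w where v: "v = (z, w)" by fastforce
    obtain l m where "l \<in> L" "z + l \<in> cball 0 R" "m \<in> M" "w + m \<in> cball 0 R'" using R R' by blast
    then show ?thesis unfolding v by (intro bexI[of _ "(l, m)"]) auto
  qed
  have pf: "f (v + l) = f v" if "l \<in> L \<times> M" for v l
    using per that by (cases v; cases l) simp
  have K1: "compact (cball (0 :: complex) R \<times> cball (0 :: complex) R')" by (intro compact_Times compact_cball)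
  have "\<exists>a b c d c1 c2. \<forall>z w. g (z, w) = (a * z + b * w + c1, c * z + d * w + c2)"
    by (rule periodic_lift_affine[OF g _ K1 K2]) (rule pf)
  then obtain a b c d c1 c2 where *: "\<forall>z w. g (z, w) = (a * z + b * w + c1, c * z + d * w + c2)"
    by (elim exE)
  have "f (z, w) = cover_S (a * z + b * w + c1, c * z + d * w + c2)" for z w
    using g(1)[of "(z, w)"] unfolding *[rule_format] by (rule sym)
  then show ?thesis by (intro exI allI)
qed

end

section \<open>Holomorphic retractions of a bielliptic surface\<close>

context bielliptic
begin

lemma lift_unique_up_to_deck:
  fixes g g' :: "complex \<times> complex \<Rightarrow> complex \<times> complex"
  assumes "continuous_on UNIV g" "continuous_on UNIV g'" "\<And>v. cover_S (g v) = cover_S (g' v)"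
  obtains l \<zeta> t where "lifts l \<zeta> t" "\<And>v. g' v = (fst (g v) + l, \<zeta> * snd (g v) + t)"
proof -
  obtain \<delta> where "screw_covering deck \<delta> cover_S" by (rule deck_covering)
  then interpret screw_covering deck \<delta> cover_S .
  obtain \<gamma> where \<gamma>: "\<gamma> \<in> deck" "\<And>v. g' v = \<gamma> (g v)" using lift_unique[OF assms] by blast
  then obtain l \<zeta> t where lt: "lifts l \<zeta> t" "\<gamma> = screw_motion l \<zeta> t" unfolding deck_def by blast
  then have "g' v = (fst (g v) + l, \<zeta> * snd (g v) + t)" for v
    using \<gamma>(2)[of v] by (simp add: screw_motion_def case_prod_unfold)
  then show ?thesis by (rule that[OF lt(1)])
qed

lemma cover_S_morphism: "fs_morphism hol_C2 (EF_mod_G L M G \<alpha>) cover_S"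
  unfolding EF_mod_G_eq by (rule fs_morphism_quotient_map)

lemma points_EF: "points (EF_mod_G L M G \<alpha>) = range cover_S"
  by (simp add: EF_mod_G_eq hol_C2_simps)

text \<open>
  Let \<open>g (z, w) = (a z + b w + c1, c z + d w + c2)\<close> lift \<open>e\<close>. Since \<open>e\<close> respects orbits, \<open>g\<close> carries the
  deck transformation with rotation part \<open>\<zeta>0 \<noteq> 1\<close> to one with translation part \<open>l'\<close> and rotation
  part \<open>\<zeta>'\<close>; comparing coefficients gives \<open>b = 0\<close>, \<open>l' = a l0\<close>, \<open>c = \<zeta>' c\<close> and \<open>d \<zeta>0 = \<zeta>' d\<close>. Since \<open>e\<close>
  is idempotent, \<open>g \<circ> g\<close> and \<open>g\<close> differ by a deck transformation, which gives \<open>a = 0\<close> or \<open>a = 1\<close>.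

  If \<open>a = 0\<close>, then \<open>l' = 0\<close> and so \<open>\<zeta>' = 1\<close>, whence \<open>d = 0\<close> and then \<open>c = 0\<close>. If \<open>a = 1\<close>, then
  \<open>l' = l0\<close> and so \<open>\<zeta>' = \<zeta>0\<close>, whence \<open>c = 0\<close>. For \<open>d \<noteq> 0\<close> the map \<open>g\<close> is onto, and an idempotent
  surjection is the identity. For \<open>d = 0\<close> the deck transformation relating \<open>g \<circ> g\<close> to \<open>g\<close> moves the
  image of \<open>g\<close> to the line of the points \<open>(z, P)\<close>; the class of \<open>(z, P)\<close> depends only on the class of
  \<open>z\<close> in \<open>E/G\<close>, which says that \<open>P\<close> is fixed by \<open>G\<close>.
\<close>

theorem retraction_cases:
  assumes e: "fs_morphism (EF_mod_G L M G \<alpha>) (EF_mod_G L M G \<alpha>) e"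
    and idem: "\<And>v. e (e (cover_S v)) = e (cover_S v)"
    and rot: "lifts l0 \<zeta>0 t0" "\<zeta>0 \<noteq> 1"
  obtains (const) p where "\<And>v. e (cover_S v) = p"
  | (identity) "\<And>v. e (cover_S v) = cover_S v"
  | (projection) P where "\<And>z w. e (cover_S (z, w)) = cover_S (z, P)" "\<And>g. g \<in> G \<Longrightarrow> \<alpha> g (tpt M P) = tpt M P"
proof -
  have per: "cover_S (z + l, w + m) = cover_S (z, w)" if "l \<in> L" "m \<in> M" for z w l m
  proof -
    have "tpt L l = tpt L 0" using that tpt_eq_iff[OF addL, of 0 l] by simp
    then have "lifts l 1 (0 + m)" using lifts_cong[OF lifts_translation[OF lifts_0 that(2)]] by blast
    then have "cover_S (z, w) = cover_S (z + l, w + m)"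
      unfolding cover_S_eq_iff by (intro exI[of _ l] exI[of _ 1] exI[of _ "0 + m"]) simp
    then show ?thesis by simp
  qed
  have per': "(e \<circ> cover_S) (z + l, w + m) = (e \<circ> cover_S) (z, w)" if "l \<in> L" "m \<in> M" for z w l m
    using per[OF that] by simp
  have "\<exists>a b c d c1 c2. \<forall>z w. (e \<circ> cover_S) (z, w) = cover_S (a * z + b * w + c1, c * z + d * w + c2)"
    by (rule morphism_lift_affine[OF fs_morphism_comp[OF cover_S_morphism e]]) (rule per')
  then obtain a b c d c1 c2 where
    f0: "\<forall>z w. (e \<circ> cover_S) (z, w) = cover_S (a * z + b * w + c1, c * z + d * w + c2)"
    by (elim exE)
  define g where "g = (\<lambda>v :: complex \<times> complex. (a * fst v + b * snd v + c1, c * fst v + d * snd v + c2))"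
  have f: "e (cover_S v) = cover_S (g v)" for v using f0[rule_format, of "fst v" "snd v"] by (simp add: g_def)
  have cg: "continuous_on UNIV g" unfolding g_def by (intro continuous_intros)
  \<comment> \<open>The given deck transformation with a proper rotation part.\<close>
  define s where "s = (\<lambda>v :: complex \<times> complex. (fst v + l0, \<zeta>0 * snd v + t0))"
  have cs: "continuous_on UNIV s" unfolding s_def by (intro continuous_intros)
  have "cover_S v = cover_S (s v)" for v
    using rot(1) cover_S_eq_iff[of "fst v" "snd v" "fst (s v)" "snd (s v)"] by (auto simp: s_def)
  then have "cover_S (g v) = cover_S (g (s v))" for v using f by metis
  then obtain l' \<zeta>' t' where lt': "lifts l' \<zeta>' t'"
    and gs: "\<And>v. g (s v) = (fst (g v) + l', \<zeta>' * snd (g v) + t')"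
    using lift_unique_up_to_deck[OF cg continuous_on_compose2[OF cg cs]] by (metis subset_UNIV)
  \<comment> \<open>The values at three affinely independent points determine the coefficients.\<close>
  have g00: "a * l0 + b * t0 + c1 = c1 + l'" "c * l0 + d * t0 + c2 = \<zeta>' * c2 + t'"
    using gs[of "(0, 0)"] by (simp_all add: g_def s_def)
  have g10: "c * (1 + l0) + d * t0 + c2 = \<zeta>' * (c + c2) + t'"
    using gs[of "(1, 0)"] by (simp add: g_def s_def)
  have g01: "a * l0 + b * (\<zeta>0 + t0) + c1 = b + c1 + l'"
    "c * l0 + d * (\<zeta>0 + t0) + c2 = \<zeta>' * (d + c2) + t'"
    using gs[of "(0, 1)"] by (simp_all add: g_def s_def)
  from arg_cong2[where f = "(-)", OF g01(1) g00(1)] have "b * (\<zeta>0 - 1) = 0" by (simp add: algebra_simps)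
  then have b: "b = 0" using rot(2) by simp
  have l': "l' = a * l0" using g00(1) b by simp
  from arg_cong2[where f = "(-)", OF g10 g00(2)] have c: "c = \<zeta>' * c" by (simp add: algebra_simps)
  from arg_cong2[where f = "(-)", OF g01(2) g00(2)] have d: "d * \<zeta>0 = \<zeta>' * d" by (simp add: algebra_simps)
  have "cover_S (g v) = cover_S (g (g v))" for v
  proof -
    have "cover_S (g v) = e (cover_S v)" by (rule f[symmetric])
    also have "\<dots> = e (e (cover_S v))" by (rule idem[symmetric])
    also have "\<dots> = cover_S (g (g v))" by (simp only: f)
    finally show ?thesis .
  qed
  then obtain l1 \<zeta>1 t1 where lt1: "lifts l1 \<zeta>1 t1"
    and gg: "\<And>v. g (g v) = (fst (g v) + l1, \<zeta>1 * snd (g v) + t1)"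
    using lift_unique_up_to_deck[OF cg continuous_on_compose2[OF cg cg]] by (metis subset_UNIV)
  have gg00: "a * c1 + c1 = c1 + l1" "c * c1 + d * c2 + c2 = \<zeta>1 * c2 + t1"
    using gg[of "(0, 0)"] by (simp_all add: g_def b)
  have gg10: "a * (a + c1) + c1 = a + c1 + l1" "c * (a + c1) + d * (c + c2) + c2 = \<zeta>1 * (c + c2) + t1"
    using gg[of "(1, 0)"] by (simp_all add: g_def b)
  from arg_cong2[where f = "(-)", OF gg10(1) gg00(1)] have aa: "a * a = a" by (simp add: algebra_simps)
  have l1: "l1 = a * c1" using gg00(1) by simp
  from arg_cong2[where f = "(-)", OF gg10(2) gg00(2)] have ca: "c * a + d * c = \<zeta>1 * c" by (simp add: algebra_simps)
  consider "a = 0" | "a = 1" "d \<noteq> 0" | "a = 1" "d = 0" using aa by force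
  then show ?thesis
  proof cases
    case 1
    have "\<zeta>' = 1" using lifts_unique_rotation(1)[OF lifts_0] lt' l' 1 by auto
    then have "d = 0" using d rot(2) by auto
    moreover have "\<zeta>1 = 1" using lifts_unique_rotation(1)[OF lifts_0] lt1 l1 1 by auto
    ultimately have "c = 0" using ca 1 by simp
    then have "e (cover_S v) = cover_S (c1, c2)" for v using f 1 b \<open>d = 0\<close> by (simp add: g_def)
    then show ?thesis by (rule const)
  next
    case 2
    have "\<zeta>' = \<zeta>0" using lifts_unique_rotation(1)[OF rot(1)] lt' l' 2 by auto
    then have c0: "c = 0" using c rot(2) by auto
    have "e (cover_S v) = cover_S v" for v
    proof -
      have "g (fst v - c1, (snd v - c2) / d) = v" using 2 b c0 by (simp add: g_def)
      then have *: "cover_S v = e (cover_S (fst v - c1, (snd v - c2) / d))" using f by simp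
      show ?thesis unfolding * by (rule idem)
    qed
    then show ?thesis by (rule identity)
  next
    case 3
    have "\<zeta>' = \<zeta>0" using lifts_unique_rotation(1)[OF rot(1)] lt' l' 3 by auto
    then have c0: "c = 0" using c rot(2) by auto
    define P where "P = (c2 - t1) / \<zeta>1"
    have "\<zeta>1 \<noteq> 0" using lt1 unfolding lifts_def by auto
    then have P: "c2 = \<zeta>1 * P + t1" by (simp add: P_def)
    have lt1': "lifts c1 \<zeta>1 t1" using lt1 l1 3 by simp
    have eP: "e (cover_S (z, w)) = cover_S (z, P)" for z w
    proof -
      have "cover_S (z, P) = cover_S (z + c1, c2)" unfolding cover_S_eq_iff using lt1' P by blast
      then show ?thesis using f[of "(z, w)"] 3 b c0 by (simp add: g_def)
    qed
    have fixP: "\<alpha> g (tpt M P) = tpt M P" if g: "g \<in> G" for g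
    proof -
      obtain l where l: "g = tpt L l" using G_tpt[OF g] .
      then have "l \<in> L'" using g by simp
      then obtain \<zeta> t where lt: "lifts l \<zeta> t" by (rule lifts_ex)
      then have "cover_S (0, 0) = cover_S (l, t)"
        unfolding cover_S_eq_iff by (intro exI[of _ l] exI[of _ \<zeta>] exI[of _ t]) simp
      then have "cover_S (0, P) = cover_S (l, P)" using eP[of 0 0] eP[of l t] by simp
      then obtain \<zeta>2 t2 where lt2: "lifts l \<zeta>2 t2" and "P = \<zeta>2 * P + t2" unfolding cover_S_eq_iff by auto
      then show ?thesis using lt2[unfolded lifts_def acts_by_def] l by metis
    qed
    show ?thesis by (rule projection[OF eP fixP])
  qed
qed

end

section \<open>Krull dimension\<close>

lemma irreducible_top_image:
  assumes irr: "irreducible_top T" and f: "continuous_map T U f" "f ` topspace T = topspace U"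
  shows "irreducible_top U"
  unfolding irreducible_top_def
proof (intro conjI allI impI)
  show "topspace U \<noteq> {}" using irr f(2) by (auto simp: irreducible_top_def)
  fix A B assume A: "closedin U A" and B: "closedin U B" and AB: "A \<union> B = topspace U"
  let ?p = "\<lambda>A. {x \<in> topspace T. f x \<in> A}"
  have "closedin T (?p A)" "closedin T (?p B)"
    using closedin_continuous_map_preimage[OF f(1)] A B by blast+
  moreover have "?p A \<union> ?p B = topspace T" using AB f(2) by blast
  ultimately have "?p A = topspace T \<or> ?p B = topspace T" using irr by (simp add: irreducible_top_def)
  moreover have "topspace U \<subseteq> A" if "?p A = topspace T" for A
    using that by (auto simp flip: f(2))
  ultimately have "topspace U \<subseteq> A \<or> topspace U \<subseteq> B" by metis
  then show "A = topspace U \<or> B = topspace U" using A B closedin_subset by blast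
qed

lemma irreducible_chain_homeomorphic:
  assumes hom: "homeomorphic_maps T U f g" and Z: "irreducible_chain T d Z"
  shows "irreducible_chain U d (\<lambda>i. f ` Z i)"
proof -
  have f: "homeomorphic_map T U f" using hom homeomorphic_map_maps by blast
  have cont: "continuous_map T U f" using hom by (simp add: homeomorphic_maps_def)
  have cl: "closedin T (Z i)" and irr: "irreducible_top (subtopology T (Z i))" if "i \<le> d" for i
    using Z that by (simp_all add: irreducible_chain_def)
  have "irreducible_top (subtopology U (f ` Z i))" if i: "i \<le> d" for i
  proof (rule irreducible_top_image[OF irr[OF i]])
    show "continuous_map (subtopology T (Z i)) (subtopology U (f ` Z i)) f"
      using cont by (auto simp: continuous_map_in_subtopology continuous_map_from_subtopology)
    have "Z i \<subseteq> topspace T" using cl[OF i] closedin_subset by blast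
    moreover have "f ` topspace T = topspace U" using f homeomorphic_imp_surjective_map by blast
    ultimately show "f ` topspace (subtopology T (Z i)) = topspace (subtopology U (f ` Z i))" by auto
  qed
  moreover have "closedin U (f ` Z i)" if "i \<le> d" for i
    using cl[OF that] f homeomorphic_map_closedness_eq by metis
  moreover have "f ` Z i \<subset> f ` Z (Suc i)" if "i < d" for i
  proof -
    have "inj_on f (topspace T)" using f homeomorphic_imp_injective_map by blast
    moreover have "Z (Suc i) \<subseteq> topspace T" using cl[of "Suc i"] that closedin_subset by auto
    moreover have "Z i \<subset> Z (Suc i)" using Z that by (simp add: irreducible_chain_def)
    ultimately show ?thesis using inj_on_image_eq_iff[of f "topspace T" "Z i" "Z (Suc i)"] by blast
  qed
  ultimately show ?thesis by (simp add: irreducible_chain_def)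
qed

text \<open>
  A homeomorphism maps chains of irreducible closed sets to such chains of the same length.
\<close>

lemma has_krull_dim_homeomorphic:
  assumes hom: "homeomorphic_maps T U f g" and T: "has_krull_dim T (Suc d)" and U: "has_krull_dim U d"
  shows False
  using irreducible_chain_homeomorphic[OF hom] T U unfolding has_krull_dim_def by blast

lemma krull_dim_pos_not_singleton:
  assumes "has_krull_dim T (Suc d)" and "topspace T \<subseteq> {c}" shows False
proof -
  obtain Z where Z: "irreducible_chain T (Suc d) Z" using assms(1) by (auto simp: has_krull_dim_def)
  then have "Z 0 \<subset> Z 1" "topspace (subtopology T (Z 0)) \<noteq> {}" "closedin T (Z 1)"
    unfolding irreducible_chain_def irreducible_top_def by simp_all
  moreover from this(3) have "Z 1 \<subseteq> topspace T" by (rule closedin_subset)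
  ultimately obtain x y where "x \<in> Z 1" "x \<notin> Z 0" "y \<in> Z 0" "x \<in> topspace T" "y \<in> topspace T" by auto
  then show False using assms(2) by auto
qed

section \<open>Fibrations with a section\<close>

lemma fs_morphism_fst: "fs_morphism hol_C2 hol_C fst"
proof (rule fs_morphismI)
  show "continuous_map (fs_top hol_C2) (fs_top hol_C) fst"
    by (simp add: hol_C2_simps hol_C_def continuous_on_fst)
  fix V and u :: "complex \<Rightarrow> complex" assume "openin (fs_top hol_C) V" "u \<in> fs_sections hol_C V"
  then have V: "open V" and u: "u holomorphic_on V" by (simp_all add: hol_C_def)
  have "hol_C2_at (u \<circ> fst) p" if p: "fst p \<in> V" for p
  proof -
    obtain u' where "(u has_field_derivative u') (at (fst p))"
      using holomorphic_on_imp_differentiable_at[OF u V p] unfolding field_differentiable_def by blast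
    then have "(u has_derivative (\<lambda>h. u' * h)) (at (fst p))" by (simp add: has_field_derivative_def)
    from has_derivative_compose[OF has_derivative_fst[OF has_derivative_ident] this]
    have "((u \<circ> fst) has_derivative (\<lambda>h. u' * fst h)) (at p)" by (simp add: o_def)
    moreover have "(\<lambda>h. u' * fst h) = (\<lambda>(v, w). u' * v + 0 * w)" by (simp add: fun_eq_iff)
    ultimately show ?thesis unfolding hol_C2_at_def by metis
  qed
  then show "u \<circ> fst \<in> fs_sections hol_C2 {x \<in> points hol_C2. fst x \<in> V}" by (simp add: hol_C2_simps)
qed

lemma fs_morphism_horizontal_line: "fs_morphism hol_C hol_C2 (\<lambda>z. (z, P))"
proof (rule fs_morphismI)
  show "continuous_map (fs_top hol_C) (fs_top hol_C2) (\<lambda>z. (z, P))"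
    by (simp add: hol_C2_simps hol_C_def continuous_intros)
  fix V and u :: "complex \<times> complex \<Rightarrow> complex" assume "u \<in> fs_sections hol_C2 V"
  then have u: "\<And>p. p \<in> V \<Longrightarrow> hol_C2_at u p" by (simp add: hol_C2_simps)
  have "(\<lambda>z. u (z, P)) field_differentiable at z" if "(z, P) \<in> V" for z
    using hol_C2_at_on_line[of u 0 z 1 P 0] u[OF that] by simp
  then show "u \<circ> (\<lambda>z. (z, P)) \<in> fs_sections hol_C {x \<in> points hol_C. (x, P) \<in> V}"
    by (auto simp: hol_C_def o_def holomorphic_on_def intro: field_differentiable_at_within)
qed

context bielliptic
begin

lemma cover_E_eq: "cover_E z = {tpt L (z + l) | l. l \<in> L'}"
proof -
  have "cover_E z = {tpt L z \<otimes>\<^bsub>torus L\<^esub> g | g. g \<in> G}" by (simp add: cover_E_def E_class_def orbit_def)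
  also have "\<dots> = {tpt L z \<otimes>\<^bsub>torus L\<^esub> tpt L l | l. l \<in> L'}" using G_tpt by blast
  finally show ?thesis by (simp add: tpt_mult[OF addL])
qed

lemma cover_E_eqD:
  assumes "cover_E z = cover_E z'" shows "z' - z \<in> L'"
proof -
  have "0 \<in> L'" using L'_additive by (simp add: additive_subgroup_def)
  then have "tpt L (z' + 0) \<in> cover_E z'" unfolding cover_E_eq by blast
  then have "tpt L z' \<in> cover_E z" using assms by simp
  then obtain l where l: "l \<in> L'" "tpt L z' = tpt L (z + l)" unfolding cover_E_eq by blast
  then have "l - (z' - z) \<in> L" by (simp add: tpt_eq_iff[OF addL] algebra_simps)
  then have "tpt L (z' - z) = tpt L l" by (simp add: tpt_eq_iff[OF addL])
  then show ?thesis using l(1) by simp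
qed

lemma fst_image_cover_S: "fst ` cover_S (z, w) = cover_E z"
proof (intro equalityI subsetI)
  fix x assume "x \<in> fst ` cover_S (z, w)"
  then obtain l \<zeta> t where "lifts l \<zeta> t" "x = tpt L (z + l)" unfolding cover_S_eq by auto
  then show "x \<in> cover_E z" unfolding cover_E_eq lifts_def by blast
next
  fix x assume "x \<in> cover_E z"
  then obtain l where l: "l \<in> L'" "x = tpt L (z + l)" unfolding cover_E_eq by blast
  obtain \<zeta> t where "lifts l \<zeta> t" using lifts_ex[OF l(1)] .
  then have "(x, tpt M (\<zeta> * w + t)) \<in> cover_S (z, w)" unfolding cover_S_eq l(2) by blast
  then show "x \<in> fst ` cover_S (z, w)" by force
qed

text \<open>
  An element of \<open>(E \<times> F)/G\<close> is an orbit of pairs, and the first coordinates of these pairs form the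
  corresponding orbit in \<open>E\<close>.
\<close>

lemma first_projection_morphism: "fs_morphism (EF_mod_G L M G \<alpha>) (E_mod_G L G) (\<lambda>K. fst ` K)"
proof -
  have "fs_morphism hol_C2 (E_mod_G L G) (cover_E \<circ> fst)"
    unfolding E_mod_G_eq by (rule fs_morphism_comp[OF fs_morphism_fst fs_morphism_quotient_map])
  moreover have "(\<lambda>K. fst ` K) \<circ> cover_S = cover_E \<circ> fst" using fst_image_cover_S by (auto simp: fun_eq_iff)
  ultimately show ?thesis unfolding EF_mod_G_eq by (intro fs_morphism_from_quotient) simp
qed

lemma cover_S_fixed_point:
  assumes P: "\<And>g. g \<in> G \<Longrightarrow> \<alpha> g (tpt M P) = tpt M P" and "cover_E z = cover_E z'"
  shows "cover_S (z, P) = cover_S (z', P)"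
proof -
  let ?l = "z' - z"
  have l: "?l \<in> L'" by (rule cover_E_eqD[OF assms(2)])
  then obtain \<zeta> t where lt: "lifts ?l \<zeta> t" by (rule lifts_ex)
  then have "tpt M (\<zeta> * P + t) = tpt M P" using P[of "tpt L ?l"] l by (simp add: lifts_def acts_by_def)
  then have "P - (\<zeta> * P + t) \<in> M" by (simp add: tpt_eq_iff[OF addM])
  from lifts_translation[OF lt this] show ?thesis
    unfolding cover_S_eq_iff by (intro exI[of _ ?l] exI[of _ \<zeta>] exI[of _ "t + (P - (\<zeta> * P + t))"]) simp
qed

text \<open>
  The idempotent \<open>e = \<psi> \<circ> \<sigma> \<circ> \<pi> \<circ> \<phi>\<close>, where \<open>\<psi>\<close> is the inverse of \<open>\<phi>\<close>, falls under \<open>retraction_cases\<close>.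
  If it were constant, \<open>C\<close> would be a point. If it were the identity, \<open>\<pi>\<close> and \<open>\<sigma>\<close> would be inverse
  homeomorphisms between spaces of dimension two and one. In the remaining case \<open>\<pi> = \<pi> \<circ> \<sigma> \<circ> \<pi>\<close>
  shows that \<open>\<pi>\<close> depends on the first coordinate only, and the first projection of \<open>\<psi> \<circ> \<sigma>\<close> is the
  inverse of the induced map \<open>h\<close>.
\<close>

theorem fibration_with_section:
  fixes S :: "(complex ^ 'm) set set" and C :: "(complex ^ 'n) set set"
  assumes rot: "lifts l0 \<zeta>0 t0" "\<zeta>0 \<noteq> 1"
    and S: "smooth_projective_variety 2 S"
    and \<phi>: "fs_iso (EF_mod_G L M G \<alpha>) (an S) \<phi>"
    and C: "smooth_projective_variety 1 C"
    and \<pi>: "fs_morphism (alg S) (alg C) \<pi>"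
    and \<sigma>: "fs_morphism (alg C) (alg S) \<sigma>"
    and \<pi>\<sigma>: "\<forall>c\<in>C. \<pi> (\<sigma> c) = c"
  obtains h P where "fs_iso (E_mod_G L G) (an C) h" "\<And>g. g \<in> G \<Longrightarrow> \<alpha> g (tpt M P) = tpt M P"
    "\<And>z w. \<pi> (\<phi> (cover_S (z, w))) = h (cover_E z)" "\<And>z. \<sigma> (h (cover_E z)) = \<phi> (cover_S (z, P))"
proof -
  have Sl: "S \<subseteq> lines" and Cl: "C \<subseteq> lines"
    using S C closedin_subset[of zariski] by (auto simp: smooth_projective_variety_def topspace_zariski)
  have dimS: "has_krull_dim (fs_top (alg S)) 2" and dimC: "has_krull_dim (fs_top (alg C)) 1"
    using S C by (simp_all add: smooth_projective_variety_def fs_sub_simps fs_top_alg_proj_space)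
  let ?EF = "EF_mod_G L M G \<alpha>"
  have \<phi>': "fs_morphism ?EF (an S) \<phi>" using \<phi> by (simp add: fs_iso_def)
  obtain \<psi> where \<psi>: "fs_morphism (an S) ?EF \<psi>" and "\<forall>x\<in>points ?EF. \<psi> (\<phi> x) = x"
    and "\<forall>y\<in>points (an S). \<phi> (\<psi> y) = y"
    using \<phi> unfolding fs_iso_def by blast
  then have \<psi>\<phi>: "\<And>v. \<psi> (\<phi> (cover_S v)) = cover_S v" and \<phi>\<psi>: "\<And>s. s \<in> S \<Longrightarrow> \<phi> (\<psi> s) = s"
    unfolding points_EF points_an[OF Sl] by blast+
  have \<pi>': "fs_morphism (an S) (an C) \<pi>" by (rule alg_morphism_imp_an_morphism[OF \<pi> Sl Cl])
  have \<sigma>': "fs_morphism (an C) (an S) \<sigma>" by (rule alg_morphism_imp_an_morphism[OF \<sigma> Cl Sl])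
  have \<phi>S: "\<phi> (cover_S v) \<in> S" for v
    using fs_morphism_points[OF \<phi>', of "cover_S v"] unfolding points_EF points_an[OF Sl] by blast
  have \<pi>C: "\<pi> s \<in> C" if "s \<in> S" for s
    using fs_morphism_points[OF \<pi>', of s] that unfolding points_an[OF Sl] points_an[OF Cl] .
  have \<sigma>S: "\<sigma> c \<in> S" if "c \<in> C" for c
    using fs_morphism_points[OF \<sigma>', of c] that unfolding points_an[OF Sl] points_an[OF Cl] .
  have \<psi>q: "\<exists>v. \<psi> s = cover_S v" if "s \<in> S" for s
    using fs_morphism_points[OF \<psi>, of s] that unfolding points_EF points_an[OF Sl] by blast
  define e where "e = \<psi> \<circ> (\<sigma> \<circ> (\<pi> \<circ> \<phi>))"
  have e: "fs_morphism ?EF ?EF e"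
    unfolding e_def by (intro fs_morphism_comp[OF _ \<psi>] fs_morphism_comp[OF _ \<sigma>'] fs_morphism_comp[OF \<phi>' \<pi>'])
  have \<phi>e: "\<phi> (e (cover_S v)) = \<sigma> (\<pi> (\<phi> (cover_S v)))" for v
    by (simp add: e_def \<phi>\<psi> \<sigma>S \<pi>C \<phi>S)
  have \<pi>e: "\<pi> (\<phi> (e (cover_S v))) = \<pi> (\<phi> (cover_S v))" for v
    using \<phi>e \<pi>\<sigma> \<pi>C[OF \<phi>S] by simp
  have idem: "e (e (cover_S v)) = e (cover_S v)" for v
    using \<pi>e[of v] by (simp add: e_def)
  have e\<sigma>: "e (\<psi> (\<sigma> c)) = \<psi> (\<sigma> c)" if "c \<in> C" for c
    using that by (simp add: e_def \<phi>\<psi> \<sigma>S \<pi>\<sigma>)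
  show ?thesis
  proof (rule retraction_cases[OF e idem rot])
    fix p assume p: "\<And>v. e (cover_S v) = p"
    have "c = \<pi> (\<phi> p)" if c: "c \<in> C" for c
    proof -
      have "\<psi> (\<sigma> c) = p" using \<psi>q[OF \<sigma>S[OF c]] e\<sigma>[OF c] p by metis
      then have "\<phi> p = \<sigma> c" using \<phi>\<psi>[OF \<sigma>S[OF c]] by simp
      then show ?thesis using \<pi>\<sigma> c by simp
    qed
    then have sub: "topspace (fs_top (alg C)) \<subseteq> {\<pi> (\<phi> p)}" unfolding points_alg[OF Cl] by blast
    have "has_krull_dim (fs_top (alg C)) (Suc 0)" using dimC by simp
    from krull_dim_pos_not_singleton[OF this sub] show thesis ..
  next
    assume id: "\<And>v. e (cover_S v) = cover_S v"
    have "\<sigma> (\<pi> s) = s" if s: "s \<in> S" for s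
    proof -
      obtain v where v: "\<psi> s = cover_S v" using \<psi>q[OF s] by blast
      have "\<phi> (cover_S v) = s" using \<phi>\<psi>[OF s] v by simp
      then show ?thesis using \<phi>e[of v] id[of v] by simp
    qed
    then have hom: "homeomorphic_maps (fs_top (alg S)) (fs_top (alg C)) \<pi> \<sigma>"
      unfolding homeomorphic_maps_def points_alg[OF Sl] points_alg[OF Cl]
      using fs_morphism_continuous[OF \<pi>] fs_morphism_continuous[OF \<sigma>] \<pi>\<sigma> by blast
    have "has_krull_dim (fs_top (alg S)) (Suc 1)" using dimS by (simp add: numeral_2_eq_2)
    from has_krull_dim_homeomorphic[OF hom this dimC] show thesis ..
  next
    fix P assume eP: "\<And>z w. e (cover_S (z, w)) = cover_S (z, P)"
      and fixP: "\<And>g. g \<in> G \<Longrightarrow> \<alpha> g (tpt M P) = tpt M P"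
    define h where "h = (\<lambda>K. \<pi> (\<phi> (cover_S (SOME z. cover_E z = K, P))))"
    have h: "h (cover_E z) = \<pi> (\<phi> (cover_S (z, P)))" for z
    proof -
      have "cover_E (SOME z'. cover_E z' = cover_E z) = cover_E z" by (rule someI) (rule refl)
      from cover_S_fixed_point[OF fixP this] show ?thesis by (simp add: h_def)
    qed
    have \<pi>h: "\<pi> (\<phi> (cover_S (z, w))) = h (cover_E z)" for z w
      using \<pi>e[of "(z, w)"] eP[of z w] h[of z] by simp
    have \<sigma>h: "\<sigma> (h (cover_E z)) = \<phi> (cover_S (z, P))" for z
      using \<phi>e[of "(z, P)"] eP[of z P] h[of z] by simp
    have "h \<circ> cover_E = (\<pi> \<circ> \<phi>) \<circ> (cover_S \<circ> (\<lambda>z. (z, P)))" by (simp add: fun_eq_iff h)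
    moreover have "fs_morphism hol_C (an C) ((\<pi> \<circ> \<phi>) \<circ> (cover_S \<circ> (\<lambda>z. (z, P))))"
      by (rule fs_morphism_comp[OF fs_morphism_comp[OF fs_morphism_horizontal_line cover_S_morphism]
            fs_morphism_comp[OF \<phi>' \<pi>']])
    ultimately have hm: "fs_morphism (E_mod_G L G) (an C) h"
      unfolding E_mod_G_eq by (intro fs_morphism_from_quotient) simp
    define k where "k = (\<lambda>K. fst ` K) \<circ> (\<psi> \<circ> \<sigma>)"
    have km: "fs_morphism (an C) (E_mod_G L G) k"
      unfolding k_def by (rule fs_morphism_comp[OF fs_morphism_comp[OF \<sigma>' \<psi>] first_projection_morphism])
    have kh: "k (h (cover_E z)) = cover_E z" for z
      by (simp add: k_def \<sigma>h \<psi>\<phi> fst_image_cover_S)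
    have hk: "h (k c) = c" if c: "c \<in> C" for c
    proof -
      obtain z w where v: "\<psi> (\<sigma> c) = cover_S (z, w)" using \<psi>q[OF \<sigma>S[OF c]] by (metis surj_pair)
      then have "h (k c) = h (cover_E z)" by (simp add: k_def fst_image_cover_S)
      also have "\<dots> = \<pi> (\<phi> (\<psi> (\<sigma> c)))" using \<pi>h v by simp
      finally show ?thesis using \<phi>\<psi>[OF \<sigma>S[OF c]] \<pi>\<sigma> c by simp
    qed
    have "fs_iso (E_mod_G L G) (an C) h"
      unfolding fs_iso_def
    proof (intro conjI exI[of _ k] hm km ballI)
      fix x assume "x \<in> points (E_mod_G L G)"
      then obtain z where "x = cover_E z" by (auto simp: E_mod_G_eq)
      then show "k (h x) = x" by (simp add: kh)
    qed (use hk points_an[OF Cl] in auto)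
    then show thesis using fixP \<pi>h \<sigma>h by (rule that)
  qed
qed

end

theorem theorem3p3:
  fixes \<rho> :: complex
    and L M :: "complex set"
    and G :: "complex set set"
    and \<alpha> :: "complex set \<Rightarrow> complex set \<Rightarrow> complex set"
    and \<tau> :: bielliptic_type
    and S :: "(complex ^ 'm) set set"
    and \<phi> :: "(complex set \<times> complex set) set \<Rightarrow> (complex ^ 'm) set"
    and C :: "(complex ^ 'n) set set"
    and \<pi> :: "(complex ^ 'm) set \<Rightarrow> (complex ^ 'n) set"
    and \<sigma> :: "(complex ^ 'n) set \<Rightarrow> (complex ^ 'm) set"
  assumes "\<rho> ^ 3 = 1" and "\<rho> \<noteq> 1"
    and "bielliptic_data L M G \<alpha>"
    and "has_bielliptic_type \<rho> \<tau> L M G \<alpha>"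
    and "smooth_projective_variety 2 S"
    and "fs_iso (EF_mod_G L M G \<alpha>) (an S) \<phi>"
    and "smooth_projective_variety 1 C"
    and "fs_morphism (alg S) (alg C) \<pi>"
    and "fs_morphism (alg C) (alg S) \<sigma>"
    and "\<forall>c\<in>C. \<pi> (\<sigma> c) = c"
  shows "\<exists>h P.
      fs_iso (E_mod_G L G) (an C) h \<and>
      P \<in> carrier (torus M) \<and> (\<forall>g\<in>G. \<alpha> g P = P) \<and>
      \<tau> \<in> {Type1, Type3, Type5, Type7} \<and>
      (\<forall>x\<in>carrier (torus L). \<forall>y\<in>carrier (torus M).
         \<pi> (\<phi> (EF_class L G \<alpha> (x, y))) = h (E_class L G x)) \<and>
      (\<forall>x\<in>carrier (torus L). \<sigma> (h (E_class L G x)) = \<phi> (EF_class L G \<alpha> (x, P)))"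
proof -
  have act: "group_action (translation_group L G) (carrier (torus M)) \<alpha>"
    using assms(3) by (simp add: bielliptic_data_def)
  note type = bielliptic_type_facts[OF assms(1,2) act assms(4)]
  interpret bielliptic L M G \<alpha>
    by (rule bielliptic.intro)
       (use assms(3) type(1) in \<open>simp_all add: bielliptic_data_def\<close>)
  obtain g \<zeta> where g: "g \<in> G" "\<zeta> \<noteq> 1" "cmod \<zeta> = 1" "acts_by M \<alpha> g (\<lambda>w. \<zeta> * w + 0)"
    using type(2) by blast
  obtain l where l: "g = tpt L l" using G_tpt[OF g(1)] .
  have "lifts l \<zeta> 0" unfolding lifts_def using g l by simp
  then obtain h P where h: "fs_iso (E_mod_G L G) (an C) h"
    and P: "\<And>g. g \<in> G \<Longrightarrow> \<alpha> g (tpt M P) = tpt M P"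
    and \<pi>h: "\<And>z w. \<pi> (\<phi> (cover_S (z, w))) = h (cover_E z)" and \<sigma>h: "\<And>z. \<sigma> (h (cover_E z)) = \<phi> (cover_S (z, P))"
    using fibration_with_section[OF _ g(2) assms(5-10)] by blast
  have "\<not> (\<exists>g\<in>G. \<exists>\<epsilon>. \<epsilon> \<notin> M \<and> acts_by M \<alpha> g (\<lambda>w. w + \<epsilon>))"
  proof
    assume "\<exists>g\<in>G. \<exists>\<epsilon>. \<epsilon> \<notin> M \<and> acts_by M \<alpha> g (\<lambda>w. w + \<epsilon>)"
    then obtain g \<epsilon> where "g \<in> G" "\<epsilon> \<notin> M" "acts_by M \<alpha> g (\<lambda>w. w + \<epsilon>)" by blast
    then have "tpt M P = tpt M (P + \<epsilon>)" using P[of g] by (simp add: acts_by_def)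
    then show False using \<open>\<epsilon> \<notin> M\<close> by (simp add: tpt_eq_iff[OF addM])
  qed
  then have \<tau>: "\<tau> \<in> {Type1, Type3, Type5, Type7}" using type(3) by blast
  show ?thesis
  proof (intro exI[of _ h] exI[of _ "tpt M P"] conjI ballI h P \<tau>)
    show "tpt M P \<in> carrier (torus M)" by (rule tpt_in_torus)
    fix x assume "x \<in> carrier (torus L)"
    then obtain z where z: "x = tpt L z" by (auto simp: carrier_torus)
    show "\<sigma> (h (E_class L G x)) = \<phi> (EF_class L G \<alpha> (x, tpt M P))"
      using \<sigma>h[of z] by (simp add: cover_E_def cover_S_def z)
    fix y assume "y \<in> carrier (torus M)"
    then obtain w where w: "y = tpt M w" by (auto simp: carrier_torus)
    show "\<pi> (\<phi> (EF_class L G \<alpha> (x, y))) = h (E_class L G x)"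
      using \<pi>h[of z w] by (simp add: cover_E_def cover_S_def z w)
  qed
qed

end
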